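(* There is an absolute constant $k_1>0$ such that for every analytic self-map $\phi$ of $\mathbb D$, every $\xi\in\mathbb T$, every $h\in(0,1-|\phi(0)|)$ and every $\varepsilon\in(0,1)$, $$\mu_\phi\big(S(\xi,\varepsilon h)\big)\le k_1\,\varepsilon\,\mu_\phi\big(S(\xi,h)\big).$$
   Context: $S(\xi,h)=\{z\in\overline{\mathbb D}:|z-\xi|<h\}$. $\mu_\phi(E)=m((\phi^* )^{-1}(E))$ for Borel $E\subseteq\overline{\mathbb D}$, where $\phi^*$ are the radial boundary values of $\phi$ and $m$ is normalized Lebesgue measure on $\mathbb T$. *)

theory Defs
  imports "HOL-Complex_Analysis.Complex_Analysis"
begin

definition carleson_box :: "complex \<Rightarrow> real \<Rightarrow> complex set" where
  "carleson_box \<xi> h = {z. cmod z \<le> 1 \<and> cmod (z - \<xi>) < h}"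

definition radial_limit :: "(complex \<Rightarrow> complex) \<Rightarrow> complex \<Rightarrow> complex \<Rightarrow> bool" where
  "radial_limit \<phi> \<zeta> w \<longleftrightarrow> ((\<lambda>r::real. \<phi> (of_real r * \<zeta>)) \<longlongrightarrow> w) (at_left 1)"

definition circle_measure :: "complex set \<Rightarrow> real" where
  "circle_measure A = measure lebesgue {t \<in> {0..<2*pi}. cis t \<in> A} / (2*pi)"

text \<open>Pullback measure mu_phi(E) = m((phi*)^{-1}(E)); phi* is the radial boundary function,
  defined at those boundary points where the radial limit exists (almost every point, by Fatou).\<close>
definition pullback_measure :: "(complex \<Rightarrow> complex) \<Rightarrow> complex set \<Rightarrow> real" where
  "pullback_measure \<phi> E = circle_measure {\<zeta>. cmod \<zeta> = 1 \<and> (\<exists>w\<in>E. radial_limit \<phi> \<zeta> w)}"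

end

(* Put s = (1 - cnj xi * phi) / h, so that Re s >= 0 on the disc, |s(0)| > 1, and phi* lies in
   S(xi,h) resp. S(xi,eps h) iff |s*| < 1 resp. |s*| < eps.  It suffices to find a bounded continuous
   superharmonic function T on the right half plane which vanishes for |s| >= 1, is >= -15 eps
   everywhere, and is >= 1/4 for |s| < eps: the mean of T(s) over |z| = r is at most T(s(0)) = 0,
   and letting r tend to 1 gives m(|s*| < eps) / 4 <= 15 eps m(|s*| < 1).  T is obtained by gluing
   the harmonic function tau(s) = 5 eps - 20 eps Re (1/(1+4s)) + Re (1/(1+s/eps)), used near 0,
   to min(0, tau), along the annulus 1/5 <= |s| <= 1/4 where tau <= 0.

   Existence of radial limits almost everywhere (Fatou): the antiderivative G of a bounded
   holomorphic function is Lipschitz, hence differentiable a.e. along the circle, and at such points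
   the Cauchy integral of G (with the reflected pole subtracted) forces G' to converge radially. *)
theory Submission
  imports Defs
begin

section \<open>Lipschitz functions are differentiable almost everywhere\<close>

text \<open>A nonzero harmonic function cannot vanish on all of |s| >= 1, which is why a minimum has
  to enter; and a minimum with 0 everywhere would destroy the positive values near s = 0, which is
  why it is switched on only beyond an annulus. The constants of tau balance three demands. Re
  (1/(1+s/eps)) is the spike: at least 1/2 for |s| <= eps, and at most eps/|s| in general, so at
  most 5 eps from |s| = 1/5 on. Re (1/(1+4s)) is at least 1/2 for |s| <= 1/4 and at most 1/4 for |s|
  >= 1. Hence 5 - 20/2 + 5 = 0 gives tau <= 0 on the annulus, 5 - 20/4 = 0 gives tau >= 0 for |s| >=
  1, and 5 - 20 = -15 bounds the loss. The spike survives as long as 15 eps <= 1/4, that is eps <=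
  1/60; for larger eps the constant 60 = 15 / (1/4) reduces the claim to monotonicity. Fatou's
  theorem serves twice: the limit of the means is read off from boundary values, and the preimages
  of the boxes have to be measurable, since \<open>measure\<close> is 0 on all other sets.\<close>

lemma Vitali_finite_intervals:
  fixes E U :: "real set"
  assumes E: "E \<in> lmeasurable" and U: "open U" "E \<subseteq> U"
    and fine: "\<And>x \<delta>. x \<in> E \<Longrightarrow> \<delta> > 0 \<Longrightarrow> \<exists>c d. c < x \<and> x < d \<and> d - c < \<delta> \<and> P c d"
    and "\<eta> > 0"
  obtains D where "finite D" "\<And>c d. (c,d) \<in> D \<Longrightarrow> c < d \<and> {c..d} \<subseteq> U \<and> P c d"
    "pairwise (\<lambda>i j. disjnt {fst i..snd i} {fst j..snd j}) D"
    "measure lebesgue E \<le> (\<Sum>i\<in>D. measure lebesgue (E \<inter> {fst i..snd i})) + \<eta>"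
proof -
  define K where "K = {(c,d). c < d \<and> {c..d} \<subseteq> U \<and> P c d}"
  define a where "a i = (fst i + snd i) / 2" for i :: "real \<times> real"
  define r where "r i = (snd i - fst i) / 2" for i :: "real \<times> real"
  have cb: "cball (a i) (r i) = {fst i..snd i}" for i
    unfolding a_def r_def cball_eq_atLeastAtMost by (auto simp: field_simps)
  have r0: "0 < r i" if "i \<in> K" for i
    using that by (auto simp: K_def r_def)
  have cov: "\<exists>i. i \<in> K \<and> x \<in> cball (a i) (r i) \<and> r i < \<delta>" if x: "x \<in> E" and "\<delta> > 0" for x \<delta>
  proof -
    obtain e where e: "e > 0" "ball x e \<subseteq> U"
      using U x by (meson openE subsetD)
    obtain c d where cd: "c < x" "x < d" "d - c < min e \<delta>" "P c d"
      using fine[OF x, of "min e \<delta>"] e \<open>\<delta> > 0\<close> by auto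
    have "{c..d} \<subseteq> ball x e"
      using cd by (auto simp: dist_real_def)
    then have "(c,d) \<in> K" using cd e by (auto simp: K_def)
    moreover have "r (c,d) < \<delta>" using cd by (auto simp: r_def)
    moreover have "x \<in> cball (a (c,d)) (r (c,d))" unfolding cb using cd by auto
    ultimately show ?thesis by blast
  qed
  \<comment> \<open>On the line a compact interval is the closed ball about its midpoint, so
    Vitali's theorem for balls applies; \<open>C\<close> is countable and covers \<open>E\<close> up
    to a null set.\<close>
  obtain C where C: "countable C" "C \<subseteq> K"
     "pairwise (\<lambda>i j. disjnt (cball (a i) (r i)) (cball (a j) (r j))) C"
     "negligible (E - (\<Union>i \<in> C. cball (a i) (r i)))"
    by (rule Vitali_covering_theorem_cballs[OF r0 cov]) auto
  define J where "J i = E \<inter> {fst i..snd i}" for i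
  have Jm: "J i \<in> lmeasurable" for i
    unfolding J_def by (intro fmeasurable_Int_fmeasurable E) auto
  have EU: "measure lebesgue E = measure lebesgue (\<Union>(J ` C))"
  proof -
    have "E = (\<Union>(J ` C)) \<union> (E - (\<Union>i \<in> C. cball (a i) (r i)))"
      by (auto simp: J_def cb)
    moreover have "(\<Union>(J ` C)) \<in> sets lebesgue"
      using C(1) Jm by (intro sets.countable_Union) auto
    ultimately show ?thesis
      using measure_Un_null_set[of "\<Union>(J ` C)" lebesgue "E - (\<Union>i \<in> C. cball (a i) (r i))"] C(4)
      by (simp add: negligible_iff_null_sets)
  qed
  \<comment> \<open>Finite unions approach the measure of the countable union; stopping there costs
    \<open>\<eta>\<close>, and the later sums over intervals become finite.\<close>
  obtain D' where D': "D' \<subseteq> J ` C" "finite D'"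
    "measure lebesgue (\<Union>(J ` C)) - \<eta> < measure lebesgue (\<Union>D')"
  proof (rule measure_countable_Union_approachable[of "J ` C" \<eta> "measure lebesgue E"])
    fix D' assume "D' \<subseteq> J ` C" "finite D'"
    then show "measure lebesgue (\<Union> D') \<le> measure lebesgue E"
      using Jm E by (intro measure_mono_fmeasurable sets.finite_Union) (auto simp: J_def)
  qed (use C \<open>\<eta> > 0\<close> Jm in auto)
  obtain D where D: "D \<subseteq> C" "finite D" "D' = J ` D"
    using finite_subset_image[OF D'(2,1)] by blast
  show ?thesis
  proof
    show "finite D" by fact
    show "c < d \<and> {c..d} \<subseteq> U \<and> P c d" if "(c,d) \<in> D" for c d
      using that D C by (auto simp: K_def)
    show "pairwise (\<lambda>i j. disjnt {fst i..snd i} {fst j..snd j}) D"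
      using pairwise_subset[OF C(3) D(1)] by (simp add: cb)
    have "measure lebesgue (\<Union>D') \<le> (\<Sum>i\<in>D. measure lebesgue (J i))"
      unfolding D(3) using Jm D by (intro measure_UNION_le) auto
    then show "measure lebesgue E \<le> (\<Sum>i\<in>D. measure lebesgue (E \<inter> {fst i..snd i})) + \<eta>"
      using D'(3) EU by (simp add: J_def)
  qed
qed

text \<open>An increment of \<open>h\<close> is the length of the interval spanned by its two
  values. Monotonicity keeps these intervals disjoint and inside [h a, h b], so additivity of
  measure replaces any sorting of the intervals.\<close>

lemma sum_increments_le:
  fixes h :: "real \<Rightarrow> real"
  assumes h: "strict_mono h" and fin: "finite D"
    and D: "\<And>c d. (c,d) \<in> D \<Longrightarrow> c < d \<and> {c..d} \<subseteq> {a..b}"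
    and disj: "pairwise (\<lambda>i j. disjnt {fst i..snd i} {fst j..snd j}) D" and "a \<le> b"
  shows "(\<Sum>i\<in>D. h (snd i) - h (fst i)) \<le> h b - h a"
proof -
  have hle: "h x \<le> h y \<longleftrightarrow> x \<le> y" for x y
    using h by (simp add: strict_mono_less_eq)
  have dj: "disjnt {h (fst i)..h (snd i)} {h (fst j)..h (snd j)}"
    if "i \<in> D" "j \<in> D" "i \<noteq> j" for i j
  proof -
    have "disjnt {fst i..snd i} {fst j..snd j}"
      using disj that by (auto simp: pairwise_def)
    moreover have "fst i < snd i" "fst j < snd j"
      using D that by (metis prod.collapse)+
    ultimately have "snd i < fst j \<or> snd j < fst i"
      by (smt (verit) disjnt_iff atLeastAtMost_iff)
    then have "h (snd i) < h (fst j) \<or> h (snd j) < h (fst i)"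
      using h by (auto simp: strict_mono_less)
    then show ?thesis by (auto simp: disjnt_iff)
  qed
  have "(\<Sum>i\<in>D. h (snd i) - h (fst i)) = (\<Sum>i\<in>D. measure lebesgue {h (fst i)..h (snd i)})"
  proof (rule sum.cong)
    fix i assume "i \<in> D"
    then have "fst i < snd i" using D by (metis prod.collapse)
    then show "h (snd i) - h (fst i) = measure lebesgue {h (fst i)..h (snd i)}"
      using hle by simp
  qed simp
  also have "\<dots> = measure lebesgue (\<Union>i\<in>D. {h (fst i)..h (snd i)})"
    using dj fin by (intro measure_UNION'[symmetric]) (auto simp: pairwise_def)
  also have "\<dots> \<le> measure lebesgue {h a..h b}"
  proof (intro measure_mono_fmeasurable)
    show "(\<Union>i\<in>D. {h (fst i)..h (snd i)}) \<subseteq> {h a..h b}"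
    proof (rule UN_least)
      fix i assume "i \<in> D"
      then have "fst i < snd i" "{fst i..snd i} \<subseteq> {a..b}" using D by (metis prod.collapse)+
      then have "h a \<le> h (fst i)" "h (snd i) \<le> h b" using hle by auto
      then show "{h (fst i)..h (snd i)} \<subseteq> {h a..h b}" by auto
    qed
  qed (use fin in auto)
  also have "\<dots> = h b - h a" using hle \<open>a \<le> b\<close> by simp
  finally show ?thesis .
qed

text \<open>Half of Lebesgue's differentiation argument: cover \<open>E\<close> by disjoint
  intervals on which \<open>h\<close> is steep. Their lengths almost exhaust \<open>E\<close>, and
  their increments together cannot exceed the total increment.\<close>

lemma measure_le_increment:
  fixes h :: "real \<Rightarrow> real"
  assumes h: "strict_mono h" and E: "E \<in> lmeasurable" "E \<subseteq> {a..b}" and "a < b" "q > 0"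
    and fine: "\<And>x \<delta>. x \<in> E \<Longrightarrow> \<delta> > 0 \<Longrightarrow> \<exists>c d. c < x \<and> x < d \<and> d - c < \<delta> \<and> q * (d - c) < h d - h c"
  shows "q * measure lebesgue E \<le> h b - h a"
proof -
  \<comment> \<open>Dropping the endpoints puts the set inside an open interval, which confines the
    covering intervals to [a, b].\<close>
  define E' where "E' = E \<inter> {a<..<b}"
  have E': "E' \<in> lmeasurable" unfolding E'_def using E by (intro fmeasurable_Int_fmeasurable) auto
  have "E = E' \<union> (E \<inter> {a,b})" using E by (auto simp: E'_def)
  moreover have "E \<inter> {a,b} \<in> null_sets lebesgue"
    by (metis finite.intros finite_Int negligible_finite negligible_iff_null_sets)
  ultimately have EE: "measure lebesgue E = measure lebesgue E'"
    using E' by (metis fmeasurableD measure_Un_null_set)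
  have "measure lebesgue E' \<le> (h b - h a) / q + \<eta>" if eta: "\<eta> > 0" for \<eta>
  proof -
    obtain D where D: "finite D" "\<And>c d. (c,d) \<in> D \<Longrightarrow> c < d \<and> {c..d} \<subseteq> {a<..<b} \<and> q * (d - c) < h d - h c"
      "pairwise (\<lambda>i j. disjnt {fst i..snd i} {fst j..snd j}) D"
      "measure lebesgue E' \<le> (\<Sum>i\<in>D. measure lebesgue (E' \<inter> {fst i..snd i})) + \<eta>"
      by (rule Vitali_finite_intervals[OF E', of "{a<..<b}" "\<lambda>c d. q * (d - c) < h d - h c" \<eta>])
         (use fine eta in \<open>auto simp: E'_def\<close>)
    have "(\<Sum>i\<in>D. measure lebesgue (E' \<inter> {fst i..snd i})) \<le> (\<Sum>i\<in>D. (h (snd i) - h (fst i)) / q)"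
    proof (rule sum_mono)
      fix i assume "i \<in> D"
      then have i: "fst i < snd i" "q * (snd i - fst i) < h (snd i) - h (fst i)"
        using D(2) by (metis prod.collapse)+
      have "measure lebesgue (E' \<inter> {fst i..snd i}) \<le> measure lebesgue {fst i..snd i}"
        using E' by (intro measure_mono_fmeasurable) auto
      also have "\<dots> = snd i - fst i" using i by simp
      also have "\<dots> \<le> (h (snd i) - h (fst i)) / q"
        using i \<open>q > 0\<close> by (simp add: field_simps)
      finally show "measure lebesgue (E' \<inter> {fst i..snd i}) \<le> (h (snd i) - h (fst i)) / q" .
    qed
    also have "\<dots> = (\<Sum>i\<in>D. h (snd i) - h (fst i)) / q" by (simp add: sum_divide_distrib)
    also have "\<dots> \<le> (h b - h a) / q"
    proof (intro divide_right_mono sum_increments_le[OF h])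
      show "c < d \<and> {c..d} \<subseteq> {a..b}" if "(c,d) \<in> D" for c d
        using D(2)[OF that] by (meson greaterThanLessThan_subseteq_atLeastAtMost_iff order_refl subset_trans)
    qed (use D \<open>a<b\<close> \<open>q > 0\<close> in auto)
    finally show ?thesis using D(4) by linarith
  qed
  then have "measure lebesgue E' \<le> (h b - h a) / q" by (rule field_le_epsilon)
  then show ?thesis using \<open>q > 0\<close> EE by (simp add: field_simps)
qed

text \<open>Choose an open \<open>U\<close> barely larger than \<open>E\<close> and disjoint shallow
  intervals in \<open>U\<close>. On each interval I the steep points give q |E \<inter> I| <=
  increment <= p |I|. Summing yields m <= (p/q) m up to small errors, and p/q < 1.\<close>

lemma measure_distinct_slopes_eq_0:
  fixes h :: "real \<Rightarrow> real"
  assumes h: "strict_mono h" and E: "E \<in> lmeasurable" and "0 < p" "p < q"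
    and up: "\<And>x \<delta>. x \<in> E \<Longrightarrow> \<delta> > 0 \<Longrightarrow> \<exists>c d. c < x \<and> x < d \<and> d - c < \<delta> \<and> q * (d - c) < h d - h c"
    and lo: "\<And>x \<delta>. x \<in> E \<Longrightarrow> \<delta> > 0 \<Longrightarrow> \<exists>c d. c < x \<and> x < d \<and> d - c < \<delta> \<and> h d - h c < p * (d - c)"
  shows "measure lebesgue E = 0"
proof -
  define m where "m = measure lebesgue E"
  define \<theta> where "\<theta> = p / q"
  have th: "0 < \<theta>" "\<theta> < 1" using assms by (auto simp: \<theta>_def)
  have "m * (1 - \<theta>) \<le> 0 + \<eta>" if "\<eta> > 0" for \<eta>
  proof -
    define e where "e = \<eta> / 2"
    have e: "e > 0" using that by (simp add: e_def)
    obtain U where U: "open U" "E \<subseteq> U" "(U - E) \<in> lmeasurable" "emeasure lebesgue (U - E) < ennreal e"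
      using sets_lebesgue_outer_open[OF fmeasurableD[OF E] e] by blast
    have Um: "U \<in> lmeasurable"
      using U(2,3) E by (metis Diff_partition fmeasurable.Un)
    have "measure lebesgue (U - E) < e"
      using U(3,4) by (simp add: emeasure_eq_measure2 ennreal_less_iff)
    moreover have "measure lebesgue U = m + measure lebesgue (U - E)"
      using U(2,3) E unfolding m_def
      using measure_Un2[of E lebesgue U] Um by (simp add: Un_absorb1)
    ultimately have mU: "measure lebesgue U \<le> m + e" by linarith
    obtain D where D: "finite D" "\<And>c d. (c,d) \<in> D \<Longrightarrow> c < d \<and> {c..d} \<subseteq> U \<and> h d - h c < p * (d - c)"
      "pairwise (\<lambda>i j. disjnt {fst i..snd i} {fst j..snd j}) D"
      "m \<le> (\<Sum>i\<in>D. measure lebesgue (E \<inter> {fst i..snd i})) + e"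
      unfolding m_def by (rule Vitali_finite_intervals[OF E U(1,2), of "\<lambda>c d. h d - h c < p * (d - c)" e])
        (use lo e in auto)
    have "(\<Sum>i\<in>D. measure lebesgue (E \<inter> {fst i..snd i})) \<le> (\<Sum>i\<in>D. \<theta> * measure lebesgue {fst i..snd i})"
    proof (rule sum_mono)
      fix i assume "i \<in> D"
      then have i: "fst i < snd i" "h (snd i) - h (fst i) < p * (snd i - fst i)"
        using D(2)[of "fst i" "snd i"] by auto
      have "q * measure lebesgue (E \<inter> {fst i..snd i}) \<le> h (snd i) - h (fst i)"
        by (rule measure_le_increment[OF h]) (use i up \<open>p<q\<close> \<open>0<p\<close> E in \<open>auto intro!: fmeasurable_Int_fmeasurable\<close>)
      then have "q * measure lebesgue (E \<inter> {fst i..snd i}) \<le> p * (snd i - fst i)"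
        using i by linarith
      then show "measure lebesgue (E \<inter> {fst i..snd i}) \<le> \<theta> * measure lebesgue {fst i..snd i}"
        using i \<open>p<q\<close> \<open>0<p\<close> by (simp add: \<theta>_def field_simps)
    qed
    also have "\<dots> = \<theta> * measure lebesgue (\<Union>i\<in>D. {fst i..snd i})"
      using D by (subst measure_UNION') (auto simp: sum_distrib_left)
    also have "\<dots> \<le> \<theta> * measure lebesgue U"
    proof (intro mult_left_mono measure_mono_fmeasurable Um)
      show "(\<Union>i\<in>D. {fst i..snd i}) \<subseteq> U"
      proof (rule UN_least)
        show "{fst i..snd i} \<subseteq> U" if "i \<in> D" for i using D(2)[of "fst i" "snd i"] that by simp
      qed
    qed (use D th in auto)
    also have "\<dots> \<le> \<theta> * (m + e)" using mU th by (intro mult_left_mono) auto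
    finally have "m \<le> \<theta> * (m + e) + e" using D(4) by linarith
    moreover have "\<theta> * e \<le> e" using th e by simp
    ultimately show ?thesis by (simp add: e_def algebra_simps)
  qed
  then have "m * (1 - \<theta>) \<le> 0" by (rule field_le_epsilon)
  then have "m \<le> 0" using th by (simp add: mult_le_0_iff)
  then show ?thesis unfolding m_def using measure_nonneg[of lebesgue E] by linarith
qed

text \<open>For each bound on the length, the points strictly inside some admissible interval form a
  union of open intervals, whatever \<open>P\<close> is. Measurability of the exceptional sets is
  thus immediate, which is the advantage of quotients over intervals straddling x.\<close>

lemma fine_points_borel:
  "{x::real. \<forall>\<delta>>0. \<exists>c d. c < x \<and> x < d \<and> d - c < \<delta> \<and> P c d} \<in> sets borel" (is "?F \<in> _")
proof -
  have "?F = (\<Inter>n::nat. \<Union>((\<lambda>(c,d). {c<..<d}) ` {(c,d). d - c < inverse (real (Suc n)) \<and> P c d}))"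
    (is "_ = (\<Inter>n. ?G n)")
  proof (intro equalityI subsetI INT_I)
    fix x n assume "x \<in> ?F"
    then show "x \<in> ?G n"
      by (simp only: mem_Collect_eq) (drule spec[of _ "inverse (real (Suc n))"], fastforce)
  next
    fix x assume x: "x \<in> (\<Inter>n. ?G n)"
    show "x \<in> ?F"
    proof (intro CollectI allI impI)
      fix \<delta> :: real assume "\<delta> > 0"
      then obtain n where n: "inverse (real (Suc n)) < \<delta>"
        using reals_Archimedean by blast
      have "x \<in> ?G n" using x by blast
      then obtain c d where "c < x" "x < d" "d - c < inverse (real (Suc n))" "P c d"
        by (auto simp del: of_nat_Suc)
      then show "\<exists>c d. c < x \<and> x < d \<and> d - c < \<delta> \<and> P c d"
        using n by (meson order.strict_trans)
    qed
  qed
  moreover have "open (?G n)" for n by (intro open_Union) auto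
  ultimately show ?thesis by (simp add: borel_open)
qed

text \<open>Letting one endpoint of a straddling interval tend to \<open>x\<close> turns the
  two-sided bounds into bounds on the quotients based at \<open>x\<close>; continuity of
  \<open>h\<close> permits the passage to the limit.\<close>

lemma slopes_imp_has_real_derivative:
  fixes h :: "real \<Rightarrow> real"
  assumes cont: "continuous_on UNIV h"
    and slopes: "\<And>e. e > 0 \<Longrightarrow> \<exists>\<delta>>0. \<forall>c d. c < x \<and> x < d \<and> d - c < \<delta> \<longrightarrow>
                   (D - e) * (d - c) \<le> h d - h c \<and> h d - h c \<le> (D + e) * (d - c)"
  shows "(h has_real_derivative D) (at x)"
proof -
  have isc: "isCont h y" for y using cont by (simp add: continuous_on_eq_continuous_at)
  have lim: "(h \<longlongrightarrow> h x) (at_left x)" "(h \<longlongrightarrow> h x) (at_right x)"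
    using isc[of x] by (auto simp: isCont_def filterlim_at_split)
  have "\<exists>d>0. \<forall>y. norm (y - x) < d \<longrightarrow> norm (h y - h x - D * (y - x)) \<le> e * norm (y - x)" if ep: "e > 0" for e
  proof -
    obtain \<delta> where \<delta>: "\<delta> > 0" "\<And>c d. c < x \<Longrightarrow> x < d \<Longrightarrow> d - c < \<delta> \<Longrightarrow>
       (D - e) * (d - c) \<le> h d - h c \<and> h d - h c \<le> (D + e) * (d - c)"
      using slopes[OF ep] by blast
    have R: "(D - e) * (d - x) \<le> h d - h x \<and> h d - h x \<le> (D + e) * (d - x)" if d: "x < d" "d - x < \<delta>" for d
    proof -
      have ev: "\<forall>\<^sub>F c in at_left x. c \<in> {d-\<delta><..<x}"
        using d by (intro eventually_at_leftI[of "d-\<delta>"]) auto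
      show ?thesis
      proof
        show "(D - e) * (d - x) \<le> h d - h x"
          by (rule tendsto_le[of "at_left x" "\<lambda>c. h d - h c" _ "\<lambda>c. (D - e) * (d - c)"])
             (use \<delta>(2)[OF _ d(1)] in \<open>auto intro!: tendsto_intros lim eventually_mono[OF ev]\<close>)
        show "h d - h x \<le> (D + e) * (d - x)"
          by (rule tendsto_le[of "at_left x" "\<lambda>c. (D + e) * (d - c)" _ "\<lambda>c. h d - h c"])
             (use \<delta>(2)[OF _ d(1)] in \<open>auto intro!: tendsto_intros lim eventually_mono[OF ev]\<close>)
      qed
    qed
    have L: "(D - e) * (x - c) \<le> h x - h c \<and> h x - h c \<le> (D + e) * (x - c)" if c: "c < x" "x - c < \<delta>" for c
    proof -
      have ev: "\<forall>\<^sub>F d in at_right x. d \<in> {x<..<c+\<delta>}"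
        using c by (intro eventually_at_rightI[of x "c+\<delta>"]) auto
      show ?thesis
      proof
        show "(D - e) * (x - c) \<le> h x - h c"
          by (rule tendsto_le[of "at_right x" "\<lambda>d. h d - h c" _ "\<lambda>d. (D - e) * (d - c)"])
             (use \<delta>(2)[OF c(1)] in \<open>auto intro!: tendsto_intros lim eventually_mono[OF ev]\<close>)
        show "h x - h c \<le> (D + e) * (x - c)"
          by (rule tendsto_le[of "at_right x" "\<lambda>d. (D + e) * (d - c)" _ "\<lambda>d. h d - h c"])
             (use \<delta>(2)[OF c(1)] in \<open>auto intro!: tendsto_intros lim eventually_mono[OF ev]\<close>)
      qed
    qed
    have "norm (h y - h x - D * (y - x)) \<le> e * norm (y - x)" if "norm (y - x) < \<delta>" for y
    proof (cases y x rule: linorder_cases)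
      case less
      then show ?thesis using L[of y] that by (auto simp: abs_le_iff algebra_simps)
    next
      case greater
      then show ?thesis using R[of y] that by (auto simp: abs_le_iff algebra_simps)
    qed auto
    then show ?thesis using \<delta>(1) by blast
  qed
  then show ?thesis
    unfolding has_field_derivative_def has_derivative_at_alt
    by (auto simp: bounded_linear_mult_right mult.commute)
qed

text \<open>Adding (L + 1) x gives a function whose slopes lie between 1 and 2 L + 1, so the
  monotone theory with positive slopes applies. Where the upper and lower straddling slopes differ,
  two rationals separate them, and countably many pairs of rationals suffice.\<close>

lemma lipschitz_differentiable_ae:
  fixes g :: "real \<Rightarrow> real"
  assumes "L-lipschitz_on UNIV g"
  obtains N where "negligible N" "\<And>x. x \<notin> N \<Longrightarrow> \<exists>D. (g has_real_derivative D) (at x)"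
proof -
  define h where "h x = g x + (L + 1) * x" for x
  have "L \<ge> 0" using assms by (rule lipschitz_on_nonneg)
  have inc: "d - c \<le> h d - h c" "h d - h c \<le> (2 * L + 1) * (d - c)" if "c \<le> d" for c d
  proof -
    have "\<bar>g d - g c\<bar> \<le> L * (d - c)"
      using lipschitz_onD[OF assms, of d c] that by (simp add: dist_real_def)
    then show "d - c \<le> h d - h c" "h d - h c \<le> (2 * L + 1) * (d - c)"
      unfolding h_def by (auto simp: algebra_simps abs_le_iff)
  qed
  have sm: "strict_mono h" 
  proof (rule strict_monoI)
    show "h c < h d" if "c < d" for c d using inc(1)[of c d] that by linarith
  qed
  have cont: "continuous_on UNIV h" unfolding h_def
    using lipschitz_on_continuous_on[OF assms] by (intro continuous_intros)
  define Up where "Up q = {x. \<forall>\<delta>>0. \<exists>c d. c < x \<and> x < d \<and> d - c < \<delta> \<and> q * (d - c) < h d - h c}" for q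
  define Lo where "Lo p = {x. \<forall>\<delta>>0. \<exists>c d. c < x \<and> x < d \<and> d - c < \<delta> \<and> h d - h c < p * (d - c)}" for p
  define N where "N = (\<Union>(p,q) \<in> {(p,q). p \<in> \<rat> \<and> q \<in> \<rat> \<and> 0 < p \<and> p < q}. Up q \<inter> Lo p)"
  have null: "negligible (Up q \<inter> Lo p)" if "0 < p" "p < q" for p q
    unfolding negligible_on_intervals[of "Up q \<inter> Lo p"]
  proof (intro allI)
    fix a b :: real
    have "Up q \<inter> Lo p \<inter> cbox a b \<in> sets borel"
      unfolding Up_def Lo_def by (intro sets.Int fine_points_borel) auto
    then have m: "Up q \<inter> Lo p \<inter> cbox a b \<in> lmeasurable"
      by (intro bounded_set_imp_lmeasurable) (auto intro: bounded_subset[OF bounded_cbox])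
    have "measure lebesgue (Up q \<inter> Lo p \<inter> cbox a b) = 0"
      by (rule measure_distinct_slopes_eq_0[OF sm m that]) (auto simp: Up_def Lo_def)
    then show "negligible (Up q \<inter> Lo p \<inter> cbox a b)"
      using m by (simp add: negligible_iff_measure0)
  qed
  show ?thesis
  proof
    have "countable {(p,q). p \<in> \<rat> \<and> q \<in> \<rat> \<and> 0 < p \<and> p < (q::real)}"
      by (rule countable_subset[of _ "\<rat> \<times> \<rat>"]) (auto simp: countable_rat)
    then show "negligible N"
      unfolding N_def by (intro negligible_countable_Union) (use null in \<open>auto\<close>)
    fix x assume x: "x \<notin> N"
    \<comment> \<open>The upper straddling derivate, the candidate for the derivative;
      \<open>low\<close> and \<open>high\<close> show that the set is nonempty and bounded.\<close>
    define D where "D = Sup {q. x \<in> Up q}"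
    have low: "q \<in> {q. x \<in> Up q}" if "q < 1" for q
    proof -
      have "\<exists>c d. c < x \<and> x < d \<and> d - c < \<delta> \<and> q * (d - c) < h d - h c" if "\<delta> > 0" for \<delta>
      proof (intro exI conjI)
        have "q * (x + \<delta>/3 - (x - \<delta>/3)) < 1 * (x + \<delta>/3 - (x - \<delta>/3))"
          using \<open>q < 1\<close> that by (intro mult_strict_right_mono) auto
        also have "\<dots> \<le> h (x + \<delta>/3) - h (x - \<delta>/3)"
          using inc(1)[of "x - \<delta>/3" "x + \<delta>/3"] that by simp
        finally show "q * (x + \<delta>/3 - (x - \<delta>/3)) < h (x + \<delta>/3) - h (x - \<delta>/3)" .
      qed (use that in auto)
      then show ?thesis by (auto simp: Up_def)
    qed
    have high: "q \<le> 2 * L + 1" if "q \<in> {q. x \<in> Up q}" for q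
    proof -
      obtain c d where "c < x" "x < d" "q * (d - c) < h d - h c"
        using \<open>q \<in> {q. x \<in> Up q}\<close> by (auto simp: Up_def dest: spec[of _ 1])
      then have "d - c > 0" "q * (d - c) < (2 * L + 1) * (d - c)" using inc(2)[of c d] by linarith+
      then show ?thesis by (simp add: mult_less_cancel_right_pos)
    qed
    have bdd: "bdd_above {q. x \<in> Up q}" using high by (rule bdd_aboveI)
    have notUp: "x \<notin> Up q" if "q > D" for q
      using cSup_upper[OF _ bdd, of q] that by (auto simp: D_def)
    have D1: "D \<ge> 1"
    proof (rule ccontr)
      assume "\<not> D \<ge> 1"
      then obtain q where "D < q" "q < 1" using dense[of D 1] by auto
      then show False using notUp low by auto
    qed
    have notLo: "x \<notin> Lo p" if "p < D" for p
    proof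
      assume p: "x \<in> Lo p"
      \<comment> \<open>The value 1/2 keeps the rational \<open>p'\<close> positive, because
        \<open>N\<close> ranges over positive slopes only.\<close>
      have "max p (1/2) < D" using that D1 by auto
      then obtain q where q: "x \<in> Up q" "max p (1/2) < q"
        using less_cSup_iff[OF _ bdd, of "max p (1/2)"] low[of 0] unfolding D_def by auto
      obtain p' where p': "p' \<in> \<rat>" "max p (1/2) < p'" "p' < q" using Rats_dense_in_real[OF q(2)] by auto
      obtain q' where q': "q' \<in> \<rat>" "p' < q'" "q' < q" using Rats_dense_in_real[OF p'(3)] by auto
      have "x \<in> Up q'" unfolding Up_def
      proof (intro CollectI allI impI)
        fix \<delta> :: real assume "\<delta> > 0"
        then obtain c d where cd: "c < x" "x < d" "d - c < \<delta>" "q * (d - c) < h d - h c"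
          using q by (auto simp: Up_def)
        moreover have "q' * (d - c) \<le> q * (d - c)" using cd q' by (intro mult_right_mono) auto
        then have "q' * (d - c) < h d - h c" using cd(4) by linarith
        ultimately show "\<exists>c d. c < x \<and> x < d \<and> d - c < \<delta> \<and> q' * (d - c) < h d - h c"
          by blast
      qed
      moreover have "x \<in> Lo p'" unfolding Lo_def
      proof (intro CollectI allI impI)
        fix \<delta> :: real assume "\<delta> > 0"
        then obtain c d where cd: "c < x" "x < d" "d - c < \<delta>" "h d - h c < p * (d - c)"
          using p by (auto simp: Lo_def)
        moreover have "p * (d - c) \<le> p' * (d - c)" using cd p' by (intro mult_right_mono) auto
        then have "h d - h c < p' * (d - c)" using cd(4) by linarith
        ultimately show "\<exists>c d. c < x \<and> x < d \<and> d - c < \<delta> \<and> h d - h c < p' * (d - c)"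
          by blast
      qed
      moreover have "(p', q') \<in> {(p,q). p \<in> \<rat> \<and> q \<in> \<rat> \<and> 0 < p \<and> p < q}" using p' q' by auto
      ultimately have "x \<in> N" unfolding N_def by blast
      then show False using x by simp
    qed
    have "(h has_real_derivative D) (at x)"
    proof (rule slopes_imp_has_real_derivative[OF cont])
      fix e :: real assume "e > 0"
      then have "x \<notin> Up (D + e)" "x \<notin> Lo (D - e)" using notUp notLo by auto
      then obtain \<delta>1 \<delta>2 where d12: "\<delta>1 > 0" "\<delta>2 > 0"
        "\<And>c d. c < x \<Longrightarrow> x < d \<Longrightarrow> d - c < \<delta>1 \<Longrightarrow> h d - h c \<le> (D + e) * (d - c)"
        "\<And>c d. c < x \<Longrightarrow> x < d \<Longrightarrow> d - c < \<delta>2 \<Longrightarrow> (D - e) * (d - c) \<le> h d - h c"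
        unfolding Up_def Lo_def mem_Collect_eq by (meson not_less)
      show "\<exists>\<delta>>0. \<forall>c d. c < x \<and> x < d \<and> d - c < \<delta> \<longrightarrow>
                   (D - e) * (d - c) \<le> h d - h c \<and> h d - h c \<le> (D + e) * (d - c)"
        by (rule exI[of _ "min \<delta>1 \<delta>2"]) (use d12 in auto)
    qed
    then have "((\<lambda>y. h y - (L + 1) * y) has_real_derivative D - (L + 1)) (at x)"
      by (auto intro!: derivative_eq_intros)
    then show "\<exists>D. (g has_real_derivative D) (at x)" by (auto simp: h_def)
  qed
qed

section \<open>Radial limits of bounded holomorphic functions\<close>

text \<open>The two poles are inverse points with respect to the unit circle, so the circle is an
  Apollonius circle for them: the ratio of the distances is constant.\<close>

lemma cmod_diff_reflection:
  assumes "cmod \<zeta> = 1" "cmod \<zeta>0 = 1" "0 < r"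
  shows "cmod (\<zeta> - \<zeta>0 / of_real r) = cmod (\<zeta> - of_real r * \<zeta>0) / r"
proof -
  have n: "\<zeta> * cnj \<zeta> = 1" "\<zeta>0 * cnj \<zeta>0 = 1"
    using assms complex_norm_square[of \<zeta>] complex_norm_square[of \<zeta>0] by auto
  have "cmod (of_real r * \<zeta> - \<zeta>0) = cmod (\<zeta> - of_real r * \<zeta>0)"
  proof -
    have "- (\<zeta> * \<zeta>0) * cnj (\<zeta> - of_real r * \<zeta>0)
        = of_real r * \<zeta> * (\<zeta>0 * cnj \<zeta>0) - \<zeta>0 * (\<zeta> * cnj \<zeta>)"
      by (simp add: algebra_simps)
    then have "of_real r * \<zeta> - \<zeta>0 = - (\<zeta> * \<zeta>0) * cnj (\<zeta> - of_real r * \<zeta>0)"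
      unfolding n by simp
    then show ?thesis using assms by (simp only: norm_mult complex_mod_cnj norm_minus_cancel)
  qed
  moreover have "\<zeta> - \<zeta>0 / of_real r = (of_real r * \<zeta> - \<zeta>0) / of_real r"
    using assms by (simp add: field_simps)
  ultimately show ?thesis using assms by (simp add: norm_divide)
qed

text \<open>Subtracting the kernel with the reflected pole gains one power of decay over the Cauchy kernel,
  so that its product with a Lipschitz-small function is dominated by the Poisson kernel.\<close>
lemma Cauchy_kernel_difference_bound:
  assumes "cmod \<zeta> = 1" "cmod \<zeta>0 = 1" "0 < r" "r < 1"
  shows "cmod (1 / (\<zeta> - of_real r * \<zeta>0)^2 - 1 / (\<zeta> - \<zeta>0 / of_real r)^2)
          \<le> 4 * (1 - r) / cmod (\<zeta> - of_real r * \<zeta>0) ^ 3"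
proof -
  define z where "z = of_real r * \<zeta>0"
  define z' where "z' = \<zeta>0 / of_real r"
  define d where "d = cmod (\<zeta> - z)"
  have "1 - r \<le> d" unfolding d_def z_def
    using norm_triangle_ineq2[of \<zeta> "of_real r * \<zeta>0"] assms by (simp add: norm_mult)
  then have d0: "d > 0" using assms by simp
  have d': "cmod (\<zeta> - z') = d / r"
    unfolding d_def z_def z'_def using cmod_diff_reflection assms by blast
  have nz: "\<zeta> - z \<noteq> 0" "\<zeta> - z' \<noteq> 0" using d0 d' assms by (auto simp: d_def)
  have "z - z' = of_real (r - 1/r) * \<zeta>0" by (simp add: z_def z'_def algebra_simps)
  then have "cmod (z - z') = \<bar>r - 1/r\<bar>"
    using assms by (simp only: norm_mult norm_of_real mult_1_right)
  moreover have "r - 1/r = - ((1 - r^2) / r)"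
    using assms by (simp add: field_simps power2_eq_square)
  moreover have "(1 - r^2) / r \<ge> 0"
    using assms by (simp add: power_le_one)
  ultimately have nzz: "cmod (z - z') = (1 - r^2) / r" by linarith
  have ns: "cmod ((\<zeta> - z) + (\<zeta> - z')) \<le> d + d / r"
    using norm_triangle_ineq[of "\<zeta> - z" "\<zeta> - z'"] d' by (simp add: d_def)
  have "1 / (\<zeta> - z)^2 - 1 / (\<zeta> - z')^2 = (z - z') * ((\<zeta> - z) + (\<zeta> - z')) / ((\<zeta> - z)^2 * (\<zeta> - z')^2)"
    using nz by (simp add: divide_simps) (simp add: power2_eq_square algebra_simps)
  then have "cmod (1 / (\<zeta> - z)^2 - 1 / (\<zeta> - z')^2)
      = (1 - r^2) / r * cmod ((\<zeta> - z) + (\<zeta> - z')) / (d^2 * (d/r)^2)"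
    by (simp only: norm_divide norm_mult norm_power nzz d') (simp add: d_def)
  also have "\<dots> \<le> (1 - r^2) / r * (d + d / r) / (d^2 * (d/r)^2)"
    using ns assms d0 by (intro divide_right_mono mult_left_mono) (auto simp: power_le_one)
  \<comment> \<open>With d + d/r = d (1 + r)/r all powers of \<open>r\<close> cancel, so the bound
    is uniform in \<open>r\<close>.\<close>
  also have "\<dots> = (1 - r) * (1 + r)^2 / d^3"
    using assms d0 by (simp add: field_simps power2_eq_square power3_eq_cube)
  also have "\<dots> \<le> (1 - r) * 2^2 / d^3"
    using assms d0 by (intro divide_right_mono mult_left_mono power_mono) auto
  finally show ?thesis by (simp add: z_def z'_def d_def mult.commute)
qed

section \<open>Cauchy and Poisson integrals over the unit circle\<close>

lemma circle_integral_iff: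
  "(f has_contour_integral I) (circlepath 0 1) \<longleftrightarrow> ((\<lambda>t. f (cis t) * \<i> * cis t) has_integral I) {0..2*pi}"
  using has_contour_integral_part_circlepath_iff[of 0 "2*pi" f I 0 1] by (simp add: circlepath_def)

text \<open>The pole lies outside the closed disc, so Cauchy's theorem applies; this is why a kernel
  with reflected pole may be subtracted from a Cauchy formula at no cost.\<close>

lemma outside_kernel_contour_integral:
  assumes "continuous_on (cball 0 1) H" "H holomorphic_on ball 0 1" "cmod w > 1"
  shows "((\<lambda>u. H u / (u - w) ^ n) has_contour_integral 0) (circlepath 0 1)"
proof (rule Cauchy_theorem_disc[of "{}" 0 1])
  have ne: "u - w \<noteq> 0" if "u \<in> cball 0 1" for u using that assms(3) by auto
  show "continuous_on (cball 0 1) (\<lambda>u. H u / (u - w) ^ n)"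
    using ne by (intro continuous_intros assms) auto
  have "(\<lambda>u. H u / (u - w) ^ n) holomorphic_on ball 0 1"
    using ne assms by (intro holomorphic_intros) auto
  then show "(\<lambda>u. H u / (u - w) ^ n) field_differentiable at x" if "x \<in> ball 0 1 - {}" for x
    using that holomorphic_on_imp_differentiable_at by blast
qed auto

text \<open>Cauchy's formula for the first derivative, taken over the unit circle itself because
  \<open>H\<close> is continuous up to the boundary; the second kernel contributes zero.\<close>

lemma deriv_circle_integral:
  assumes H: "continuous_on (cball 0 1) H" "H holomorphic_on ball 0 1"
    and r: "cmod \<zeta>0 = 1" "0 < r" "r < 1"
  shows "((\<lambda>t. H (cis t) * (1 / (cis t - of_real r * \<zeta>0)^2 - 1 / (cis t - \<zeta>0 / of_real r)^2) * \<i> * cis t)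
          has_integral (2 * pi * \<i> * deriv H (of_real r * \<zeta>0))) {0..2*pi}"
proof -
  have "of_real r * \<zeta>0 \<in> ball 0 1" using r by (simp add: norm_mult)
  from Cauchy_has_contour_integral_higher_derivative_circlepath[OF H this, of 1]
  have "((\<lambda>u. H u / (u - of_real r * \<zeta>0)^2) has_contour_integral (2 * pi * \<i> * deriv H (of_real r * \<zeta>0))) (circlepath 0 1)"
    by (simp add: numeral_2_eq_2)
  moreover have "((\<lambda>u. H u / (u - \<zeta>0 / of_real r)^2) has_contour_integral 0) (circlepath 0 1)"
    using r by (intro outside_kernel_contour_integral H) (simp add: norm_divide)
  ultimately have "((\<lambda>u. H u / (u - of_real r * \<zeta>0)^2 - H u / (u - \<zeta>0 / of_real r)^2)
      has_contour_integral (2 * pi * \<i> * deriv H (of_real r * \<zeta>0) - 0)) (circlepath 0 1)"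
    by (rule has_contour_integral_diff)
  then show ?thesis
    unfolding circle_integral_iff by (simp add: right_diff_distrib)
qed

text \<open>On the circle the Poisson kernel is the difference of the Cauchy kernels at two inverse
  points, multiplied by the variable. Cauchy's formula for the constant 1 then gives the total
  mass.\<close>

lemma Poisson_kernel_integral:
  assumes r: "cmod \<zeta>0 = 1" "0 < r" "r < 1"
  shows "((\<lambda>t. (1 - r^2) / cmod (cis t - of_real r * \<zeta>0)^2) has_integral 2 * pi) {0..2*pi}"
proof -
  have "((\<lambda>u. 1 / (u - of_real r * \<zeta>0)) has_contour_integral (2 * of_real pi * \<i> * 1)) (circlepath 0 1)"
    using r by (intro Cauchy_integral_circlepath) (auto simp: norm_mult)
  moreover have "((\<lambda>u. 1 / (u - \<zeta>0 / of_real r)) has_contour_integral 0) (circlepath 0 1)"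
    using outside_kernel_contour_integral[of "\<lambda>_. 1" "\<zeta>0 / of_real r" 1] r by (simp add: norm_divide)
  ultimately have "((\<lambda>u. 1 / (u - of_real r * \<zeta>0) - 1 / (u - \<zeta>0 / of_real r))
      has_contour_integral (2 * of_real pi * \<i> * 1 - 0)) (circlepath 0 1)"
    by (rule has_contour_integral_diff)
  then have I: "((\<lambda>t. (1 / (cis t - of_real r * \<zeta>0) - 1 / (cis t - \<zeta>0 / of_real r)) * \<i> * cis t)
      has_integral (2 * of_real pi * \<i>)) {0..2*pi}"
    unfolding circle_integral_iff by simp
  have eq: "(1 / (cis t - of_real r * \<zeta>0) - 1 / (cis t - \<zeta>0 / of_real r)) * \<i> * cis t
     = \<i> * of_real ((1 - r^2) / cmod (cis t - of_real r * \<zeta>0)^2)" for t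
  proof -
    define \<zeta> where "\<zeta> = cis t"
    have z1: "cmod \<zeta> = 1" by (simp add: \<zeta>_def)
    have n: "\<zeta> * cnj \<zeta> = 1" "\<zeta>0 * cnj \<zeta>0 = 1"
      using z1 r complex_norm_square[of \<zeta>] complex_norm_square[of \<zeta>0] by auto
    have "1 - r \<le> cmod (\<zeta> - of_real r * \<zeta>0)"
      using norm_triangle_ineq2[of \<zeta> "of_real r * \<zeta>0"] r z1 by (simp add: norm_mult)
    then have nz1: "\<zeta> - of_real r * \<zeta>0 \<noteq> 0" using r by auto
    then have nz2: "\<zeta> - \<zeta>0 / of_real r \<noteq> 0"
      using cmod_diff_reflection[OF z1 r(1,2)] r by (metis norm_eq_zero divide_eq_0_iff less_irrefl)
    have rr: "of_real r \<noteq> (0::complex)" using r by simp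
    have nz3: "of_real r * \<zeta> - \<zeta>0 \<noteq> 0" using nz2 rr by (auto simp: field_simps)
    have nz4: "cnj \<zeta> - of_real r * cnj \<zeta>0 \<noteq> 0"
      using nz1 by (metis complex_cnj_cnj complex_cnj_complex_of_real complex_cnj_diff complex_cnj_mult complex_cnj_zero)
    have sq: "of_real (cmod (\<zeta> - of_real r * \<zeta>0)^2) = (\<zeta> - of_real r * \<zeta>0) * (cnj \<zeta> - of_real r * cnj \<zeta>0)"
      using complex_norm_square[of "\<zeta> - of_real r * \<zeta>0"] by simp
    \<comment> \<open>The relations \<zeta> * cnj \<zeta> = 1 and \<zeta>0 * cnj \<zeta>0 = 1
      produce the factor with the reflected pole, which then cancels from the denominator.\<close>
    have key: "(of_real r * \<zeta>0 - \<zeta>0 / of_real r) * \<zeta> * (cnj \<zeta> - of_real r * cnj \<zeta>0)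
        = (1 - of_real r^2) * (\<zeta> - \<zeta>0 / of_real r)"
    proof -
      have "(of_real r * \<zeta>0 - \<zeta>0 / of_real r) * \<zeta> * (cnj \<zeta> - of_real r * cnj \<zeta>0)
        = (of_real r - 1 / of_real r) * (\<zeta>0 * (\<zeta> * cnj \<zeta>) - of_real r * \<zeta> * (\<zeta>0 * cnj \<zeta>0))"
        by (simp add: algebra_simps)
      also have "\<dots> = (1 - of_real r^2) * (\<zeta> - \<zeta>0 / of_real r)"
        unfolding n using rr by (simp add: field_simps power2_eq_square)
      finally show ?thesis .
    qed
    have "1 / (\<zeta> - of_real r * \<zeta>0) - 1 / (\<zeta> - \<zeta>0 / of_real r)
       = (of_real r * \<zeta>0 - \<zeta>0 / of_real r) / ((\<zeta> - of_real r * \<zeta>0) * (\<zeta> - \<zeta>0 / of_real r))"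
      by (subst diff_frac_eq[OF nz1 nz2]) simp
    then have "(1 / (\<zeta> - of_real r * \<zeta>0) - 1 / (\<zeta> - \<zeta>0 / of_real r)) * \<zeta>
       = ((of_real r * \<zeta>0 - \<zeta>0 / of_real r) * \<zeta> * (cnj \<zeta> - of_real r * cnj \<zeta>0))
          / ((\<zeta> - of_real r * \<zeta>0) * (\<zeta> - \<zeta>0 / of_real r) * (cnj \<zeta> - of_real r * cnj \<zeta>0))"
      using nz4 by simp
    also have "\<dots> = (1 - of_real r^2) / ((\<zeta> - of_real r * \<zeta>0) * (cnj \<zeta> - of_real r * cnj \<zeta>0))"
      unfolding key using nz2 by simp
    finally have "(1 / (\<zeta> - of_real r * \<zeta>0) - 1 / (\<zeta> - \<zeta>0 / of_real r)) * \<zeta>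
       = of_real ((1 - r^2) / cmod (\<zeta> - of_real r * \<zeta>0)^2)"
      unfolding of_real_divide sq by simp
    then show ?thesis unfolding \<zeta>_def by (simp add: mult_ac)
  qed
  from I have "((\<lambda>t. \<i> * of_real ((1 - r^2) / cmod (cis t - of_real r * \<zeta>0)^2)) has_integral (2 * of_real pi * \<i>)) {0..2*pi}"
    unfolding eq .
  from has_integral_linear[OF this bounded_linear_Im] show ?thesis
    by (simp add: o_def)
qed

text \<open>Subtracting the affine approximation leaves \<open>H\<close> with H(\<zeta>) =
  o(|\<zeta> - \<zeta>0|) on the circle. Near \<zeta>0 its product with the kernel difference is at
  most a small multiple of the Poisson kernel; on the rest of the circle the kernel is O(1 -
  r).\<close>

lemma radial_limit_deriv:
  assumes G: "continuous_on (cball 0 1) G" "G holomorphic_on ball 0 1"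
    and z0: "cmod \<zeta>0 = 1"
    and A: "\<And>e. e > 0 \<Longrightarrow> \<exists>\<delta>>0. \<forall>\<zeta>. cmod \<zeta> = 1 \<and> cmod (\<zeta> - \<zeta>0) < \<delta> \<longrightarrow>
                cmod (G \<zeta> - G \<zeta>0 - A * (\<zeta> - \<zeta>0)) \<le> e * cmod (\<zeta> - \<zeta>0)"
  shows "radial_limit (deriv G) \<zeta>0 A"
proof -
  define H where "H \<zeta> = G \<zeta> - G \<zeta>0 - A * (\<zeta> - \<zeta>0)" for \<zeta>
  have contH: "continuous_on (cball 0 1) H" unfolding H_def by (intro continuous_intros G)
  have holH: "H holomorphic_on ball 0 1" unfolding H_def by (intro holomorphic_intros G)
  have dH: "deriv H z = deriv G z - A" if "z \<in> ball 0 1" for z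
  proof -
    have "(G has_field_derivative deriv G z) (at z)"
      using holomorphic_derivI[OF G(2) _ that] by simp
    then have "(H has_field_derivative deriv G z - A) (at z)"
      unfolding H_def by (auto intro!: derivative_eq_intros)
    then show ?thesis by (rule DERIV_imp_deriv)
  qed
  have "compact (H ` cball 0 1)" using contH by (intro compact_continuous_image) auto
  then obtain C where C: "C > 0" "\<And>z. cmod z \<le> 1 \<Longrightarrow> cmod (H z) \<le> C"
    using compact_imp_bounded[of "H ` cball 0 1"] by (auto simp: bounded_pos)
  have bound: "cmod (deriv G (of_real r * \<zeta>0) - A) \<le> 8 * e + 32 * C * (1 - r) / \<delta>^3"
    if e: "e > 0" and \<delta>: "\<delta> > 0" "\<And>\<zeta>. cmod \<zeta> = 1 \<Longrightarrow> cmod (\<zeta> - \<zeta>0) < \<delta> \<Longrightarrow> cmod (H \<zeta>) \<le> e * cmod (\<zeta> - \<zeta>0)"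
      and r: "0 < r" "r < 1" for e \<delta> r
  proof -
    let ?k = "\<lambda>\<zeta>. 1 / (\<zeta> - of_real r * \<zeta>0)^2 - 1 / (\<zeta> - \<zeta>0 / of_real r)^2"
    let ?M = "32 * C * (1 - r) / \<delta>^3"
    let ?b = "\<lambda>t. 8 * e * ((1 - r^2) / cmod (cis t - of_real r * \<zeta>0)^2) + ?M"
    have pt: "cmod (H \<zeta> * ?k \<zeta>) \<le> 8 * e * ((1 - r^2) / cmod (\<zeta> - of_real r * \<zeta>0)^2) + ?M"
      if z: "cmod \<zeta> = 1" for \<zeta>
    proof -
      define d where "d = cmod (\<zeta> - of_real r * \<zeta>0)"
      have dr: "1 - r \<le> d" unfolding d_def
        using norm_triangle_ineq2[of \<zeta> "of_real r * \<zeta>0"] z0 r z by (simp add: norm_mult)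
      then have d0: "d > 0" using r by simp
      have "cmod (of_real r * \<zeta>0 - \<zeta>0) = 1 - r"
      proof -
        have "of_real r * \<zeta>0 - \<zeta>0 = of_real (r - 1) * \<zeta>0" by (simp add: algebra_simps)
        then show ?thesis using r z0 by (simp only: norm_mult norm_of_real) simp
      qed
      \<comment> \<open>Both |\<zeta> - r \<zeta>0| = d and |r \<zeta>0 - \<zeta>0| = 1 - r are at
        most \<open>d\<close>. One factor \<open>d\<close> of the cubic kernel bound is thereby
        absorbed by \<open>H\<close>.\<close>
      then have d2: "cmod (\<zeta> - \<zeta>0) \<le> 2 * d"
        using norm_triangle_ineq[of "\<zeta> - of_real r * \<zeta>0" "of_real r * \<zeta>0 - \<zeta>0"] dr by (simp add: d_def)
      have r2: "1 - r \<le> 1 - r^2" using r by (simp add: power2_eq_square mult_le_cancel_left1)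
      have M0: "?M \<ge> 0" using C r \<delta> by simp
      have k: "cmod (?k \<zeta>) \<le> 4 * (1 - r) / d^3"
        unfolding d_def by (rule Cauchy_kernel_difference_bound[OF z z0 r])
      show ?thesis
      proof (cases "cmod (\<zeta> - \<zeta>0) < \<delta>")
        case True
        have "cmod (H \<zeta> * ?k \<zeta>) \<le> (e * (2 * d)) * (4 * (1 - r) / d^3)"
          unfolding norm_mult
        proof (intro mult_mono k)
          show "cmod (H \<zeta>) \<le> e * (2 * d)"
            using \<delta>(2)[OF z True] d2 e by (meson order_trans mult_left_mono less_imp_le)
        qed (use e d0 in auto)
        also have "\<dots> = 8 * e * ((1 - r) / d^2)"
          using d0 by (simp add: field_simps power2_eq_square power3_eq_cube)
        also have "\<dots> \<le> 8 * e * ((1 - r^2) / d^2)"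
          using r2 e by (intro mult_left_mono divide_right_mono) auto
        finally show ?thesis using M0 unfolding d_def by linarith
      next
        case False
        \<comment> \<open>Away from \<zeta>0 the pole stays at distance \<delta>/2, whence the
          constant 32 = 4 * 2^3 in \<open>?M\<close>.\<close>
        then have dd: "\<delta> / 2 \<le> d" using d2 by simp
        have "cmod (H \<zeta> * ?k \<zeta>) \<le> C * (4 * (1 - r) / (\<delta>/2)^3)"
          unfolding norm_mult
        proof (intro mult_mono)
          show "cmod (H \<zeta>) \<le> C" using C z by simp
          have "4 * (1 - r) / d^3 \<le> 4 * (1 - r) / (\<delta>/2)^3"
            using dd \<delta>(1) r d0 by (intro divide_left_mono power_mono mult_pos_pos) auto
          then show "cmod (?k \<zeta>) \<le> 4 * (1 - r) / (\<delta>/2)^3" using k by linarith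
        qed (use C in auto)
        also have "\<dots> = ?M" by (simp add: power_divide)
        moreover have "8 * e * ((1 - r^2) / d^2) \<ge> 0" using e r by (auto simp: power_le_one)
        ultimately show ?thesis unfolding d_def by linarith
      qed
    qed
    have I: "((\<lambda>t. H (cis t) * ?k (cis t) * \<i> * cis t) has_integral (2 * pi * \<i> * deriv H (of_real r * \<zeta>0))) {0..2*pi}"
      by (rule deriv_circle_integral[OF contH holH z0 r])
    have B: "(?b has_integral (8 * e * (2 * pi) + ?M * (2 * pi))) {0..2*pi}"
      using has_integral_add[OF has_integral_mult_right[OF Poisson_kernel_integral[OF z0 r], of "8 * e"]
          has_integral_const_real[of ?M 0 "2*pi"]] by (simp add: mult.commute)
    have "cmod (integral {0..2*pi} (\<lambda>t. H (cis t) * ?k (cis t) * \<i> * cis t)) \<le> integral {0..2*pi} ?b"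
    proof (rule integral_norm_bound_integral)
      show "cmod (H (cis t) * ?k (cis t) * \<i> * cis t) \<le> ?b t" for t
        using pt[of "cis t"] by (simp add: norm_mult)
    qed (use I B in \<open>auto simp: has_integral_iff\<close>)
    then have "cmod (2 * pi * \<i> * deriv H (of_real r * \<zeta>0)) \<le> 8 * e * (2 * pi) + ?M * (2 * pi)"
      using I B by (simp only: has_integral_iff)
    moreover have "cmod (2 * pi * \<i> * deriv H (of_real r * \<zeta>0)) = cmod (deriv H (of_real r * \<zeta>0)) * (2 * pi)"
      by (simp add: norm_mult)
    ultimately have "cmod (deriv H (of_real r * \<zeta>0)) * (2 * pi) \<le> (8 * e + ?M) * (2 * pi)"
      by (simp add: distrib_right)
    then have "cmod (deriv H (of_real r * \<zeta>0)) \<le> 8 * e + ?M"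
      by (rule mult_right_le_imp_le) simp
    then show ?thesis using dH[of "of_real r * \<zeta>0"] r z0 by (simp add: norm_mult)
  qed
  show ?thesis
    unfolding radial_limit_def
  proof (rule tendstoI)
    fix e :: real assume e: "e > 0"
    then have "e/16 > 0" by simp
    from A[OF this] obtain \<delta> where \<delta>: "\<delta> > 0" "\<And>\<zeta>. cmod \<zeta> = 1 \<Longrightarrow> cmod (\<zeta> - \<zeta>0) < \<delta> \<Longrightarrow> cmod (H \<zeta>) \<le> e/16 * cmod (\<zeta> - \<zeta>0)"
      unfolding H_def by blast
    have "((\<lambda>r. 32 * C * (1 - r) / \<delta>^3) \<longlongrightarrow> 32 * C * (1 - 1) / \<delta>^3) (at_left 1)"
      using \<delta>(1) by (intro tendsto_intros) auto
    then have "\<forall>\<^sub>F r in at_left 1. 32 * C * (1 - r) / \<delta>^3 < e/2"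
      using e by (intro order_tendstoD(2)) auto
    moreover have "\<forall>\<^sub>F r in at_left (1::real). r \<in> {0<..<1}"
      by (rule eventually_at_leftI[of 0]) auto
    ultimately show "\<forall>\<^sub>F r in at_left 1. dist (deriv G (of_real r * \<zeta>0)) A < e"
    proof eventually_elim
      case (elim r)
      then show ?case using bound[of "e/16" \<delta> r] \<delta> e by (auto simp: dist_norm)
    qed
  qed
qed

section \<open>Passing between angles and chords, and Fatou's theorem\<close>

lemma cis_lipschitz: "cmod (cis s - cis t) \<le> \<bar>s - t\<bar>"
proof -
  have "cis s - cis t = cis t * (cis (s - t) - 1)"
    by (simp add: right_diff_distrib cis_mult)
  then have "cmod (cis s - cis t) = cmod (cis (s - t) - 1)"
    by (simp only: norm_mult norm_cis mult_1)
  also have "\<dots> = 2 * \<bar>sin ((s - t) / 2)\<bar>"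
    using dist_exp_i_1[of "s - t"] by (simp only: cis_conv_exp)
  also have "\<dots> \<le> \<bar>s - t\<bar>" using abs_sin_x_le_abs_x[of "(s-t)/2"] by simp
  finally show ?thesis .
qed

text \<open>A local converse to \<open>cis_lipschitz\<close>: the angle is found from the principal
  logarithm of the quotient, which is purely imaginary and at most twice its distance from
  1.\<close>

lemma unit_circle_nearby_angle:
  assumes "cmod \<zeta> = 1" "cmod (\<zeta> - cis t) < 1/2"
  obtains s where "\<zeta> = cis s" "\<bar>s - t\<bar> \<le> 2 * cmod (\<zeta> - cis t)"
proof -
  define w where "w = \<zeta> / cis t"
  have w: "cmod w = 1" "w \<noteq> 0" using assms by (auto simp: w_def norm_divide)
  have "w - 1 = (\<zeta> - cis t) / cis t" by (simp add: w_def field_simps)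
  then have w1: "cmod (w - 1) = cmod (\<zeta> - cis t)" by (simp add: norm_divide)
  have L: "cmod (Ln w) \<le> 2 * cmod (w - 1)"
    using norm_Ln_le[of "w - 1"] assms w1 by simp
  have "Re (Ln w) = 0" using w by simp
  then have "Ln w = \<i> * of_real (Im (Ln w))" by (simp add: complex_eq_iff)
  then have "w = cis (Im (Ln w))" using w(2) by (metis cis_conv_exp exp_Ln)
  then have "\<zeta> = cis (t + Im (Ln w))"
    by (metis w_def cis_mult cis_neq_zero mult.commute nonzero_eq_divide_eq)
  moreover have "\<bar>t + Im (Ln w) - t\<bar> \<le> 2 * cmod (\<zeta> - cis t)"
    using abs_Im_le_cmod[of "Ln w"] L w1 by simp
  ultimately show ?thesis by (rule that)
qed

text \<open>Since cis has derivative \<i> * cis t, the quotient D / (\<i> * cis t) makes the error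
  term have derivative zero in the angle; comparing angle with chord then costs a factor 2.\<close>

lemma tangential_derivative_imp_circle_derivative:
  fixes G :: "complex \<Rightarrow> complex"
  assumes D: "((\<lambda>s. G (cis s)) has_vector_derivative D) (at t)" and "e > 0"
  shows "\<exists>\<delta>>0. \<forall>\<zeta>. cmod \<zeta> = 1 \<and> cmod (\<zeta> - cis t) < \<delta> \<longrightarrow>
           cmod (G \<zeta> - G (cis t) - D / (\<i> * cis t) * (\<zeta> - cis t)) \<le> e * cmod (\<zeta> - cis t)"
proof -
  let ?H = "\<lambda>\<zeta>. G \<zeta> - G (cis t) - D / (\<i> * cis t) * (\<zeta> - cis t)"
  have c: "(cis has_vector_derivative \<i> * cis t) (at t)"
    unfolding has_vector_derivative_complex_iff by (auto intro!: derivative_eq_intros)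
  have "((\<lambda>s. ?H (cis s)) has_vector_derivative (D - 0 - D / (\<i> * cis t) * (\<i> * cis t - 0))) (at t)"
    by (intro has_vector_derivative_diff D has_vector_derivative_const
        has_vector_derivative_mult_right c)
  then have "((\<lambda>s. ?H (cis s)) has_vector_derivative 0) (at t)" by simp
  then have "\<forall>e>0. \<exists>d>0. \<forall>s. norm (s - t) < d \<longrightarrow>
      norm (?H (cis s) - ?H (cis t) - (s - t) *\<^sub>R 0) \<le> e * norm (s - t)"
    unfolding has_vector_derivative_def has_derivative_at_alt by (rule conjunct2)
  then obtain d where d: "d > 0" "\<And>s. norm (s - t) < d \<Longrightarrow>
      norm (?H (cis s) - ?H (cis t) - (s - t) *\<^sub>R 0) \<le> e/2 * norm (s - t)"
    using \<open>e > 0\<close> by (meson half_gt_zero)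
  have d: "d > 0" "\<And>s. \<bar>s - t\<bar> < d \<Longrightarrow> cmod (?H (cis s)) \<le> e/2 * \<bar>s - t\<bar>"
    using d by simp_all
  show ?thesis
  proof (intro exI[of _ "min (1/2) (d/2)"] conjI allI impI)
    show "0 < min (1/2) (d/2)" using d by simp
    fix \<zeta> assume z: "cmod \<zeta> = 1 \<and> cmod (\<zeta> - cis t) < min (1/2) (d/2)"
    then obtain s where s: "\<zeta> = cis s" "\<bar>s - t\<bar> \<le> 2 * cmod (\<zeta> - cis t)"
      using unit_circle_nearby_angle[of \<zeta> t] by auto
    then have "cmod (?H \<zeta>) \<le> e/2 * \<bar>s - t\<bar>" using d(2)[of s] z by auto
    also have "\<dots> \<le> e/2 * (2 * cmod (\<zeta> - cis t))" using s \<open>e>0\<close> by (intro mult_left_mono) auto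
    finally show "cmod (?H \<zeta>) \<le> e * cmod (\<zeta> - cis t)" by simp
  qed
qed

lemma Fatou_radial_limits:
  assumes f: "f holomorphic_on ball 0 1" and B: "\<And>z. z \<in> ball 0 1 \<Longrightarrow> cmod (f z) \<le> B"
  obtains N where "negligible N" "\<And>t. t \<notin> N \<Longrightarrow> \<exists>w. radial_limit f (cis t) w"
proof -
  obtain F where F: "\<And>z. z \<in> ball 0 1 \<Longrightarrow> (F has_field_derivative f z) (at z within ball 0 1)"
    using holomorphic_convex_primitive'[OF convex_ball open_ball f] by blast
  have B0: "B \<ge> 0" using B[of 0] norm_ge_zero[of "f 0"] by (metis centre_in_ball order_trans zero_less_one)
  have "B-lipschitz_on (ball 0 1) F"
  proof (rule lipschitz_onI)
    show "dist (F x) (F y) \<le> B * dist x y" if "x \<in> ball 0 1" "y \<in> ball 0 1" for x y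
      unfolding dist_norm by (rule field_differentiable_bound[OF convex_ball F B that])
  qed (rule B0)
  \<comment> \<open>The primitive, unlike \<open>f\<close> itself, extends continuously to the unit
    circle, where both the tangential derivative and the Cauchy integral are taken.\<close>
  then obtain G where G: "B-lipschitz_on (closure (ball 0 1)) G" "\<And>z. z \<in> ball 0 1 \<Longrightarrow> G z = F z"
    using lipschitz_extend_closure by blast
  have Gl: "B-lipschitz_on (cball 0 1) G" using G(1) by simp
  have Gd: "(G has_field_derivative f z) (at z)" if "z \<in> ball 0 1" for z
  proof -
    have "(F has_field_derivative f z) (at z)"
      using F[OF that] by (simp only: at_within_open[OF that open_ball])
    then show ?thesis
      by (rule has_field_derivative_transform_within_open[OF _ open_ball that]) (simp add: G(2))
  qed
  have Gc: "continuous_on (cball 0 1) G" using Gl by (rule lipschitz_on_continuous_on)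
  have Gh: "G holomorphic_on ball 0 1"
    unfolding holomorphic_on_open[OF open_ball] using Gd by blast
  have lip: "cmod (G (cis s) - G (cis t)) \<le> B * \<bar>s - t\<bar>" for s t
  proof -
    have "cmod (G (cis s) - G (cis t)) \<le> B * cmod (cis s - cis t)"
      using lipschitz_onD[OF Gl, of "cis s" "cis t"] by (simp add: dist_norm)
    also have "\<dots> \<le> B * \<bar>s - t\<bar>" using cis_lipschitz B0 by (intro mult_left_mono)
    finally show ?thesis .
  qed
  have l1: "B-lipschitz_on UNIV (\<lambda>t. Re (G (cis t)))"
  proof (rule lipschitz_onI)
    show "dist (Re (G (cis s))) (Re (G (cis t))) \<le> B * dist s t" for s t
      using lip[of s t] abs_Re_le_cmod[of "G (cis s) - G (cis t)"] by (simp add: dist_real_def)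
  qed (rule B0)
  have l2: "B-lipschitz_on UNIV (\<lambda>t. Im (G (cis t)))"
  proof (rule lipschitz_onI)
    show "dist (Im (G (cis s))) (Im (G (cis t))) \<le> B * dist s t" for s t
      using lip[of s t] abs_Im_le_cmod[of "G (cis s) - G (cis t)"] by (simp add: dist_real_def)
  qed (rule B0)
  obtain N1 where N1: "negligible N1" "\<And>t. t \<notin> N1 \<Longrightarrow> \<exists>D. ((\<lambda>t. Re (G (cis t))) has_real_derivative D) (at t)"
    using lipschitz_differentiable_ae[OF l1] by blast
  obtain N2 where N2: "negligible N2" "\<And>t. t \<notin> N2 \<Longrightarrow> \<exists>D. ((\<lambda>t. Im (G (cis t))) has_real_derivative D) (at t)"
    using lipschitz_differentiable_ae[OF l2] by blast
  show ?thesis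
  proof
    show "negligible (N1 \<union> N2)" using N1 N2 by (simp add: negligible_Un)
    fix t assume "t \<notin> N1 \<union> N2"
    then obtain D1 D2 where
      "((\<lambda>t. Re (G (cis t))) has_real_derivative D1) (at t)"
      "((\<lambda>t. Im (G (cis t))) has_real_derivative D2) (at t)"
      using N1(2)[of t] N2(2)[of t] by auto
    then have "((\<lambda>t. G (cis t)) has_vector_derivative (Complex D1 D2)) (at t)"
      by (simp add: has_vector_derivative_complex_iff)
    then have "radial_limit (deriv G) (cis t) (Complex D1 D2 / (\<i> * cis t))"
      by (intro radial_limit_deriv Gc Gh tangential_derivative_imp_circle_derivative) auto
    moreover have "\<forall>\<^sub>F r in at_left (1::real). deriv G (of_real r * cis t) = f (of_real r * cis t)"
      by (rule eventually_at_leftI[of 0]) (use Gd in \<open>auto intro!: DERIV_imp_deriv simp: norm_mult\<close>)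
    ultimately have "radial_limit f (cis t) (Complex D1 D2 / (\<i> * cis t))"
      unfolding radial_limit_def by (simp add: tendsto_cong)
    then show "\<exists>w. radial_limit f (cis t) w" ..
  qed
qed

section \<open>The superharmonic barrier\<close>

text \<open>Cauchy's formula at the centre, where du/(u - z) becomes \<i> dt.\<close>

lemma holomorphic_circle_mean:
  fixes f :: "complex \<Rightarrow> complex"
  assumes "continuous_on (cball z \<rho>) f" "f holomorphic_on ball z \<rho>" "\<rho> > 0"
  shows "((\<lambda>t. f (z + of_real \<rho> * cis t)) has_integral 2 * pi * f z) {0..2*pi}"
proof -
  have "((\<lambda>u. f u / (u - z)) has_contour_integral (2 * of_real pi * \<i> * f z)) (part_circlepath z \<rho> 0 (2*pi))"
    using Cauchy_integral_circlepath[OF assms(1,2), of z] assms(3) by (simp add: circlepath_def)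
  then have "((\<lambda>t. \<i> * f (z + of_real \<rho> * cis t)) has_integral (2 * of_real pi * \<i> * f z)) {0..2*pi}"
    using assms(3) by (subst (asm) has_contour_integral_part_circlepath_iff) (simp_all add: mult_ac)
  from has_integral_mult_right[OF this, of "-\<i>"]
  have "((\<lambda>t. f (z + of_real \<rho> * cis t)) has_integral (- \<i> * (2 * of_real pi * \<i> * f z))) {0..2*pi}"
    by (simp add: mult.assoc[symmetric])
  moreover have "- \<i> * (2 * of_real pi * \<i> * f z) = 2 * pi * f z"
    by (simp add: complex_eq_iff)
  ultimately show ?thesis by (simp only:)
qed

lemma circle_integral_rotate:
  fixes g :: "complex \<Rightarrow> real"
  assumes g: "continuous_on (sphere 0 1) g" and w: "cmod w = 1"
  shows "integral {0..2*pi} (\<lambda>t. g (w * cis t)) = integral {0..2*pi} (\<lambda>t. g (cis t))"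
proof -
  define a where "a = Arg2pi w"
  have a: "w = cis a" "0 \<le> a" "a \<le> 2 * pi"
    using Arg2pi[of w] w by (auto simp: a_def cis_conv_exp is_Arg_def less_imp_le)
  have cont: "continuous_on UNIV (\<lambda>t. g (cis t))"
    by (rule continuous_on_compose2[OF g]) (auto intro!: continuous_intros)
  have int: "(\<lambda>t. g (cis t)) integrable_on {x..y}" for x y
    by (rule integrable_continuous_real) (rule continuous_on_subset[OF cont], simp)
  have "integral {0..2*pi} (\<lambda>t. g (w * cis t)) = integral {0..2*pi} (\<lambda>t. g (cis (t + a)))"
    by (simp add: a cis_mult add.commute)
  also have "\<dots> = integral {a..2*pi + a} (\<lambda>t. g (cis t))"
    using integral_shift_real_ivl[of a a "2*pi + a" "\<lambda>t. g (cis t)"] by simp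
  also have "\<dots> = integral {a..2*pi} (\<lambda>t. g (cis t)) + integral {2*pi..2*pi+a} (\<lambda>t. g (cis t))"
    using Henstock_Kurzweil_Integration.integral_combine[OF a(3) _ int[of a "2*pi+a"]] a by simp
  also have "integral {2*pi..2*pi+a} (\<lambda>t. g (cis t)) = integral {0..a} (\<lambda>t. g (cis (t + 2*pi)))"
    using integral_shift_real_ivl[of "2*pi" "2*pi" "2*pi + a" "\<lambda>t. g (cis t)"] by simp
  also have "\<dots> = integral {0..a} (\<lambda>t. g (cis t))" by (simp flip: cis_mult)
  also have "integral {a..2*pi} (\<lambda>t. g (cis t)) + integral {0..a} (\<lambda>t. g (cis t)) = integral {0..2*pi} (\<lambda>t. g (cis t))"
    using Henstock_Kurzweil_Integration.integral_combine[OF a(2,3) int[of 0 "2*pi"]] by simp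
  finally show ?thesis .
qed

text \<open>The rotational average of \<open>v\<close> inherits the local super-mean property, so it attains its minimum
  over the disc on the boundary circle, where it is constant.  This avoids solving a Dirichlet problem.\<close>
lemma local_super_mean_imp_super_mean:
  fixes v :: "complex \<Rightarrow> real"
  assumes v: "continuous_on (cball 0 r) v" and "r > 0" "\<rho>0 > 0"
    and super: "\<And>z \<rho>. 0 < \<rho> \<Longrightarrow> \<rho> \<le> \<rho>0 \<Longrightarrow> cmod z + \<rho> \<le> r \<Longrightarrow>
                  integral {0..2*pi} (\<lambda>t. v (z + of_real \<rho> * cis t)) \<le> 2 * pi * v z"
  shows "integral {0..2*pi} (\<lambda>t. v (of_real r * cis t)) \<le> 2 * pi * v 0"
proof -
  define S where "S z = integral {0..2*pi} (\<lambda>t. v (z * cis t))" for z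
  have S_cont: "continuous_on (cball 0 r) S"
  proof -
    have "continuous_on (cball 0 r \<times> cbox 0 (2*pi)) (\<lambda>(z,t). v (z * cis t))"
      unfolding split_beta
      by (rule continuous_on_compose2[OF v]) (auto intro!: continuous_intros simp: norm_mult)
    from integral_continuous_on_param[OF this] show ?thesis
      unfolding S_def by simp
  qed
  have "\<exists>z\<in>cball 0 r. \<forall>y\<in>cball 0 r. S z \<le> S y"
    using S_cont \<open>r > 0\<close> by (intro continuous_attains_inf) auto
  then obtain z1 where z1: "z1 \<in> cball 0 r" "\<And>y. y \<in> cball 0 r \<Longrightarrow> S z1 \<le> S y" by blast
  define m where "m = S z1"
  define M where "M = {z \<in> cball 0 r. S z = m}"
  have "closed M" unfolding M_def
    using S_cont by (intro continuous_closed_preimage_constant) auto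
  moreover have "cball 0 r \<inter> M = M" by (auto simp: M_def)
  ultimately have "compact M"
    using compact_Int_closed[of "cball 0 r" M] by simp
  moreover have "M \<noteq> {}" using z1 by (auto simp: M_def m_def)
  ultimately have "\<exists>z\<in>M. \<forall>y\<in>M. cmod y \<le> cmod z"
    by (intro continuous_attains_sup) (auto intro!: continuous_intros)
  \<comment> \<open>Among all minimum points of \<open>S\<close>, one of greatest modulus. If it
    were interior, \<open>S\<close> would equal its minimum on a whole circle about it, and that
    circle contains points of larger modulus.\<close>
  then obtain z2 where z2: "z2 \<in> M" "\<And>y. y \<in> M \<Longrightarrow> cmod y \<le> cmod z2" by blast
  have z2r: "cmod z2 \<le> r" "S z2 = m" using z2 by (auto simp: M_def)
  have "cmod z2 = r"
  proof (rule ccontr)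
    assume "cmod z2 \<noteq> r"
    then have lt: "cmod z2 < r" using z2r by simp
    define \<rho> where "\<rho> = min \<rho>0 (r - cmod z2)"
    have \<rho>: "0 < \<rho>" "\<rho> \<le> \<rho>0" "cmod z2 + \<rho> \<le> r" using lt \<open>\<rho>0 > 0\<close> by (auto simp: \<rho>_def)
    have in_disc: "cmod (z2 * w + of_real \<rho> * w') \<le> r" if "cmod w = 1" "cmod w' = 1" for w w'
      using norm_triangle_ineq[of "z2 * w" "of_real \<rho> * w'"] that \<rho> by (simp add: norm_mult)
    have cont2: "continuous_on (cbox (0,0) (2*pi,2*pi)) (\<lambda>(u,t). v ((z2 + of_real \<rho> * cis u) * cis t))"
      unfolding split_beta
    proof (rule continuous_on_compose2[OF v])
      show "(\<lambda>p. (z2 + of_real \<rho> * cis (fst p)) * cis (snd p)) ` cbox (0,0) (2*pi,2*pi) \<subseteq> cball 0 r"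
        using in_disc[of 1] by (auto simp: norm_mult)
    qed (auto intro!: continuous_intros)
    \<comment> \<open>The super-mean property passes to \<open>S\<close>: exchange the integrals,
      undo the rotation of the inner circle, and apply \<open>super\<close> at each centre z2 * cis
      t, all of which have the same modulus.\<close>
    have "integral {0..2*pi} (\<lambda>u. S (z2 + of_real \<rho> * cis u))
        = integral {0..2*pi} (\<lambda>t. integral {0..2*pi} (\<lambda>u. v ((z2 + of_real \<rho> * cis u) * cis t)))"
      using integral_swap_continuous[OF cont2] unfolding S_def by simp
    also have "\<dots> = integral {0..2*pi} (\<lambda>t. integral {0..2*pi} (\<lambda>u. v (z2 * cis t + of_real \<rho> * cis u)))"
    proof (rule integral_cong)
      fix t :: real
      have "continuous_on (sphere 0 1) (\<lambda>w. v (z2 * cis t + of_real \<rho> * w))"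
        by (rule continuous_on_compose2[OF v]) (use in_disc[of "cis t"] in \<open>auto intro!: continuous_intros\<close>)
      from circle_integral_rotate[OF this, of "cis t"]
      show "integral {0..2*pi} (\<lambda>u. v ((z2 + of_real \<rho> * cis u) * cis t))
          = integral {0..2*pi} (\<lambda>u. v (z2 * cis t + of_real \<rho> * cis u))"
        by (simp add: algebra_simps)
    qed
    also have "\<dots> \<le> integral {0..2*pi} (\<lambda>t. 2 * pi * v (z2 * cis t))"
    proof (rule integral_le)
      show "(\<lambda>t. 2 * pi * v (z2 * cis t)) integrable_on {0..2*pi}"
        by (rule integrable_continuous_real, rule continuous_on_mult_left, rule continuous_on_compose2[OF v])
           (use z2r in \<open>auto intro!: continuous_intros simp: norm_mult\<close>)
      have "continuous_on ({0..2*pi} \<times> cbox 0 (2*pi)) (\<lambda>(t,u). v (z2 * cis t + of_real \<rho> * cis u))"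
        unfolding split_beta
        by (rule continuous_on_compose2[OF v]) (use in_disc in \<open>auto intro!: continuous_intros\<close>)
      from integral_continuous_on_param[OF this]
      show "(\<lambda>t. integral {0..2*pi} (\<lambda>u. v (z2 * cis t + of_real \<rho> * cis u))) integrable_on {0..2*pi}"
        by (intro integrable_continuous_real) simp
      show "integral {0..2*pi} (\<lambda>u. v (z2 * cis t + of_real \<rho> * cis u)) \<le> 2 * pi * v (z2 * cis t)" for t
        by (rule super) (use \<rho> in \<open>auto simp: norm_mult\<close>)
    qed
    also have "\<dots> = 2 * pi * m" using z2r(2) by (simp add: S_def)
    finally have le: "integral {0..2*pi} (\<lambda>u. S (z2 + of_real \<rho> * cis u)) \<le> 2 * pi * m" .
    have disc1: "cmod (z2 + of_real \<rho> * cis u) \<le> r" for u using in_disc[of 1 "cis u"] by simp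
    have contS: "continuous_on {0..2*pi} (\<lambda>u. S (z2 + of_real \<rho> * cis u))"
      by (rule continuous_on_compose2[OF S_cont]) (use disc1 in \<open>auto intro!: continuous_intros\<close>)
    have ge: "S (z2 + of_real \<rho> * cis u) - m \<ge> 0" for u
      using z1(2)[of "z2 + of_real \<rho> * cis u"] disc1 by (simp add: m_def)
    have contD: "continuous_on {0..2*pi} (\<lambda>u. S (z2 + of_real \<rho> * cis u) - m)"
      by (intro continuous_intros contS)
    have "integral {0..2*pi} (\<lambda>u. S (z2 + of_real \<rho> * cis u) - m) = integral {0..2*pi} (\<lambda>u. S (z2 + of_real \<rho> * cis u)) - 2 * pi * m"
      using integrable_continuous_real[OF contS] by (subst Henstock_Kurzweil_Integration.integral_diff) auto
    then have "integral {0..2*pi} (\<lambda>u. S (z2 + of_real \<rho> * cis u) - m) \<le> 0" using le by simp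
    moreover have "integral {0..2*pi} (\<lambda>u. S (z2 + of_real \<rho> * cis u) - m) \<ge> 0"
      using ge by (intro integral_nonneg integrable_continuous_real contD) auto
    ultimately have "((\<lambda>u. S (z2 + of_real \<rho> * cis u) - m) has_integral 0) (cbox 0 (2*pi))"
      using integrable_integral[OF integrable_continuous_real[OF contD]] by simp
    then have zero: "S (z2 + of_real \<rho> * cis u) - m = 0" if "u \<in> {0..2*pi}" for u
      using has_integral_0_cbox_imp_0[of 0 "2*pi" "\<lambda>u. S (z2 + of_real \<rho> * cis u) - m" u] contD ge that
        pi_gt_zero by (simp add: not_le)
    \<comment> \<open>The direction of \<open>z2\<close> itself picks the outermost point of the
      circle.\<close>
    define u where "u = Arg2pi z2"
    have "z2 = of_real (cmod z2) * cis u"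
      using Arg2pi[of z2] by (simp add: u_def is_Arg_def cis_conv_exp)
    from arg_cong[OF this, of "\<lambda>z. z + of_real \<rho> * cis u"]
    have "z2 + of_real \<rho> * cis u = of_real (cmod z2 + \<rho>) * cis u"
      by (simp only: distrib_right of_real_add)
    then have nrm: "cmod (z2 + of_real \<rho> * cis u) = cmod z2 + \<rho>"
      using \<rho>(1) by (simp only: norm_mult norm_of_real norm_cis) simp
    have "u \<in> {0..2*pi}" using Arg2pi[of z2] by (auto simp: u_def less_imp_le)
    then have "z2 + of_real \<rho> * cis u \<in> M" using zero disc1 by (simp add: M_def)
    from z2(2)[OF this] have "cmod (z2 + of_real \<rho> * cis u) \<le> cmod z2" .
    then show False using nrm \<rho>(1) by linarith
  qed
  define w where "w = z2 / of_real r"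
  have w: "cmod w = 1" "z2 = of_real r * w"
    using \<open>cmod z2 = r\<close> \<open>r > 0\<close> by (auto simp: w_def norm_divide)
  have "continuous_on (sphere 0 1) (\<lambda>x. v (of_real r * x))"
    by (rule continuous_on_compose2[OF v]) (use \<open>r > 0\<close> in \<open>auto intro!: continuous_intros simp: norm_mult\<close>)
  from circle_integral_rotate[OF this w(1)]
  \<comment> \<open>By rotation invariance the boundary integral is the value of \<open>S\<close> at
    the boundary point \<open>z2\<close>, hence its minimum, which is compared with the value at the
    centre.\<close>
  have "integral {0..2*pi} (\<lambda>t. v (of_real r * cis t)) = S z2"
    by (simp add: S_def w(2) mult.assoc)
  also have "\<dots> \<le> S 0" using z1(2)[of 0] z2r \<open>r > 0\<close> by (simp add: m_def)
  also have "\<dots> = 2 * pi * v 0" by (simp add: S_def)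
  finally show ?thesis .
qed

text \<open>Always v <= Re G, so the super-mean property is clear wherever v = Re G. Elsewhere v =
  min 0 (Re G) on the whole of a small circle, and the mean is below both entries. The overlap a <=
  |s| <= b guarantees that one case applies to every sufficiently small circle.\<close>

lemma glued_min_super_mean:
  fixes s G :: "complex \<Rightarrow> complex" and a b :: real
  defines "v \<equiv> \<lambda>z. if cmod (s z) \<le> b then Re (G z) else min 0 (Re (G z))"
  assumes s: "continuous_on (cball 0 r) s" and G: "continuous_on (cball 0 r) G" "G holomorphic_on ball 0 r"
    and "r > 0" "a < b"
    and neg: "\<And>z. z \<in> cball 0 r \<Longrightarrow> a \<le> cmod (s z) \<Longrightarrow> cmod (s z) \<le> b \<Longrightarrow> Re (G z) \<le> 0"
  shows "continuous_on (cball 0 r) v"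
    and "integral {0..2*pi} (\<lambda>t. v (of_real r * cis t)) \<le> 2 * pi * v 0"
proof -
  show vc: "continuous_on (cball 0 r) v"
    unfolding v_def
  proof (rule continuous_on_cases_le)
    show "Re (G z) = min 0 (Re (G z))" if "z \<in> cball 0 r" "cmod (s z) = b" for z
      using neg[of z] that \<open>a < b\<close> by simp
  qed (auto intro!: continuous_intros s continuous_on_subset[OF G(1)])
  \<comment> \<open>Half the width of the overlap: by uniform continuity |s| changes by less than
    this on small circles, so a centre beyond a + e keeps its circle in |s| >= a.\<close>
  define e where "e = (b - a) / 2"
  have e: "e > 0" using \<open>a < b\<close> by (simp add: e_def)
  have "uniformly_continuous_on (cball 0 r) s"
    using s by (intro compact_uniformly_continuous) auto
  then obtain d where d: "d > 0" "\<And>x y. x \<in> cball 0 r \<Longrightarrow> y \<in> cball 0 r \<Longrightarrow> dist y x < d \<Longrightarrow> dist (s y) (s x) < e"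
    unfolding uniformly_continuous_on_def using e by blast
  show "integral {0..2*pi} (\<lambda>t. v (of_real r * cis t)) \<le> 2 * pi * v 0"
  proof (rule local_super_mean_imp_super_mean[OF vc \<open>r > 0\<close>, of "d/2"])
    show "d/2 > 0" using d by simp
    fix z and \<rho> :: real
    assume \<rho>: "0 < \<rho>" "\<rho> \<le> d/2" "cmod z + \<rho> \<le> r"
    have zr: "z \<in> cball 0 r" using \<rho> by simp
    have sub: "cball z \<rho> \<subseteq> cball 0 r" "ball z \<rho> \<subseteq> ball 0 r"
      using \<rho> by (auto simp: cball_subset_cball_iff ball_subset_ball_iff)
    have mean: "((\<lambda>t. G (z + of_real \<rho> * cis t)) has_integral 2 * pi * G z) {0..2*pi}"
      using sub G \<rho>(1) by (intro holomorphic_circle_mean) (auto intro: continuous_on_subset holomorphic_on_subset)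
    have "((\<lambda>t. Re (G (z + of_real \<rho> * cis t))) has_integral Re (2 * pi * G z)) {0..2*pi}"
      using has_integral_linear[OF mean bounded_linear_Re] by (simp add: o_def)
    then have mean: "((\<lambda>t. Re (G (z + of_real \<rho> * cis t))) has_integral 2 * pi * Re (G z)) {0..2*pi}"
      by simp
    have pc: "z + of_real \<rho> * cis t \<in> cball 0 r" for t
    proof -
      have "z + of_real \<rho> * cis t \<in> cball z \<rho>" using \<rho>(1) by (simp add: dist_norm norm_mult)
      then show ?thesis using sub(1) by blast
    qed
    have close: "\<bar>cmod (s (z + of_real \<rho> * cis t)) - cmod (s z)\<bar> < e" for t
    proof -
      have "dist (z + of_real \<rho> * cis t) z < d" using \<rho> by (simp add: dist_norm norm_mult)
      from d(2)[OF zr pc this] show ?thesis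
        using norm_triangle_ineq3[of "s (z + of_real \<rho> * cis t)" "s z"] by (simp add: dist_norm)
    qed
    have vle: "v z \<le> Re (G z)" for z by (auto simp: v_def)
    have vint: "(\<lambda>t. v (z + of_real \<rho> * cis t)) integrable_on {0..2*pi}"
      by (rule integrable_continuous_real, rule continuous_on_compose2[OF vc]) (use pc in \<open>auto intro!: continuous_intros\<close>)
    have le1: "integral {0..2*pi} (\<lambda>t. v (z + of_real \<rho> * cis t)) \<le> 2 * pi * Re (G z)"
      using integral_le[OF vint has_integral_integrable[OF mean] vle] mean by (simp add: has_integral_iff)
    show "integral {0..2*pi} (\<lambda>t. v (z + of_real \<rho> * cis t)) \<le> 2 * pi * v z"
    proof (cases "cmod (s z) \<le> a + e")
      case True
      also have "a + e \<le> b" using \<open>a < b\<close> by (simp add: e_def field_simps)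
      finally have "v z = Re (G z)" by (simp add: v_def)
      then show ?thesis using le1 by simp
    next
      case False
      have vmin: "v y = min 0 (Re (G y))" if "y \<in> cball 0 r" "a \<le> cmod (s y)" for y
        using neg[OF that] unfolding v_def by (cases "cmod (s y) \<le> b") auto
      have "v (z + of_real \<rho> * cis t) \<le> 0" for t
      proof -
        have "a \<le> cmod (s (z + of_real \<rho> * cis t))" using close[of t] False by linarith
        from vmin[OF pc this] show ?thesis by simp
      qed
      then have "integral {0..2*pi} (\<lambda>t. v (z + of_real \<rho> * cis t)) \<le> integral {0..2*pi} (\<lambda>t::real. 0)"
        by (intro integral_le vint) auto
      moreover have "v z = min 0 (Re (G z))" using vmin[OF zr] False e by linarith
      then have "v z = 0 \<or> v z = Re (G z)" by (auto simp: min_def)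
      ultimately show ?thesis using le1 by auto
    qed
  qed
qed

text \<open>The barrier is superharmonic on the right half plane: near the circle \<open>|s| = 1/4\<close> both branches
  agree, because \<open>Re (barrier_tau K s) \<le> 0\<close> for \<open>1/5 \<le> |s| \<le> 1/4\<close>.\<close>
definition barrier_tau :: "real \<Rightarrow> complex \<Rightarrow> complex" where
  "barrier_tau K s = of_real (5/K) - of_real (20/K) * (1 / (1 + 4 * s)) + 1 / (1 + of_real K * s)"

definition barrier :: "real \<Rightarrow> complex \<Rightarrow> real" where
  "barrier K s = (if cmod s \<le> 1/4 then Re (barrier_tau K s) else min 0 (Re (barrier_tau K s)))"

section \<open>Explicit estimates for the barrier\<close>

lemma cmod_one_plus_ge:
  assumes "Re w \<ge> 0"
  shows "cmod (1 + w) \<ge> 1" "cmod (1 + w) \<ge> cmod w"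
proof -
  show "cmod (1 + w) \<ge> 1" using complex_Re_le_cmod[of "1 + w"] assms by simp
  show "cmod (1 + w) \<ge> cmod w"
    using assms by (simp add: cmod_def real_sqrt_le_mono power_mono)
qed

text \<open>The map w -> 1/(1 + w) carries the right half plane into the disc with diameter [0, 1].
  The upper bounds come from |1 + w| >= max 1 |w|, the last lower bound from |1 + w|^2 <= 2 (1 + Re
  w) for |w| <= 1.\<close>

lemma Re_inverse_one_plus:
  assumes "Re w \<ge> 0"
  shows "0 \<le> Re (1 / (1 + w))" "Re (1 / (1 + w)) \<le> 1" "cmod w * Re (1 / (1 + w)) \<le> 1"
    "cmod w \<le> 1 \<Longrightarrow> 1/2 \<le> Re (1 / (1 + w))"
proof -
  have Re_eq: "Re (1 / (1 + w)) = (1 + Re w) / (cmod (1 + w))\<^sup>2"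
    by (simp add: Re_divide cmod_power2)
  have g: "cmod (1 + w) \<ge> 1" "cmod (1 + w) \<ge> cmod w" using cmod_one_plus_ge[OF assms] by auto
  show "0 \<le> Re (1 / (1 + w))" unfolding Re_eq using assms by simp
  have le: "Re (1 / (1 + w)) \<le> 1 / cmod (1 + w)"
    using complex_Re_le_cmod[of "1 / (1 + w)"] by (simp add: norm_divide)
  also have "1 / cmod (1 + w) \<le> 1" using g(1) by (subst divide_le_eq_1) auto
  finally show "Re (1 / (1 + w)) \<le> 1" .
  have "cmod w * Re (1 / (1 + w)) \<le> cmod w * (1 / cmod (1 + w))"
    using le by (intro mult_left_mono) auto
  also have "\<dots> \<le> 1" using g by (simp add: divide_le_eq_1)
  finally show "cmod w * Re (1 / (1 + w)) \<le> 1" .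
  assume w: "cmod w \<le> 1"
  have "(cmod (1 + w))\<^sup>2 = 1 + 2 * Re w + (cmod w)\<^sup>2"
    unfolding cmod_power2 by (simp add: power2_eq_square algebra_simps)
  also have "\<dots> \<le> 2 * (1 + Re w)" using w by (simp add: power_le_one)
  finally have "(cmod (1 + w))\<^sup>2 \<le> 2 * (1 + Re w)" .
  moreover have "(cmod (1 + w))\<^sup>2 > 0" using g(1) by (intro zero_less_power) linarith
  ultimately show "1/2 \<le> Re (1 / (1 + w))"
    unfolding Re_eq by (simp add: field_simps)
qed

lemma Re_barrier_tau:
  "Re (barrier_tau K s) = 5/K - 20/K * Re (1 / (1 + 4 * s)) + Re (1 / (1 + of_real K * s))"
proof -
  have "Re (of_real c * z) = c * Re z" for c z by simp
  then show ?thesis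
    unfolding barrier_tau_def plus_complex.sel minus_complex.sel Re_complex_of_real by presburger
qed

lemma barrier_bounds:
  assumes s: "Re s \<ge> 0" and K: "K > 60"
  shows "1/5 \<le> cmod s \<Longrightarrow> cmod s \<le> 1/4 \<Longrightarrow> Re (barrier_tau K s) \<le> 0"
    and "1 \<le> cmod s \<Longrightarrow> barrier K s = 0"
    and "cmod s < 1/K \<Longrightarrow> barrier K s \<ge> 1/4"
    and "barrier K s \<ge> - (15/K)"
    and "\<bar>barrier K s\<bar> \<le> 2"
proof -
  define A where "A = Re (1 / (1 + 4 * s))"
  define C where "C = Re (1 / (1 + of_real K * s))"
  have tau: "Re (barrier_tau K s) = 5/K - 20/K * A + C"
    unfolding Re_barrier_tau A_def C_def ..
  have r: "Re (4 * s) \<ge> 0" "Re (of_real K * s) \<ge> 0" using s K by auto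
  have A: "0 \<le> A" "A \<le> 1" "4 * cmod s * A \<le> 1" "4 * cmod s \<le> 1 \<Longrightarrow> 1/2 \<le> A"
    using Re_inverse_one_plus[OF r(1)] unfolding A_def by (auto simp: norm_mult)
  have C: "0 \<le> C" "C \<le> 1" "K * cmod s * C \<le> 1" "K * cmod s \<le> 1 \<Longrightarrow> 1/2 \<le> C"
    using Re_inverse_one_plus[OF r(2)] K unfolding C_def by (auto simp: norm_mult)
  have K0: "K > 0" using K by simp
  show "Re (barrier_tau K s) \<le> 0" if "1/5 \<le> cmod s" "cmod s \<le> 1/4"
  proof -
    have "K * (1/5) * C \<le> K * cmod s * C" using that C K0 by (intro mult_right_mono mult_left_mono) auto
    then have "C \<le> 5 / K" using C(3) K0 by (simp add: field_simps)
    moreover have "20/K * A \<ge> 20/K * (1/2)" using A(4) that K0 by (intro mult_left_mono) auto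
    ultimately show ?thesis unfolding tau by simp
  qed
  show "barrier K s = 0" if "1 \<le> cmod s"
  proof -
    have "1 * A \<le> cmod s * A" using that A by (intro mult_right_mono)
    then have "A \<le> 1/4" using A(3) by simp
    then have "20/K * A \<le> 20/K * (1/4)" using K0 by (intro mult_left_mono) auto
    then have "Re (barrier_tau K s) \<ge> 0" unfolding tau using C by simp
    then show ?thesis using that by (simp add: barrier_def)
  qed
  have A20: "20/K * A \<le> 20/K" "0 \<le> 20/K * A" "5/K \<ge> 0"
    using mult_left_mono[of A 1 "20/K"] A K0 by simp_all
  \<comment> \<open>The threshold 60 comes from the first inequality: the spike of height 1/2 then
    keeps 1/4 after the loss of 15/K.\<close>
  have K15: "15/K \<le> 1/4" "5/K \<le> 1" "20/K \<le> 1" using K by (simp_all add: field_simps)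
  show "barrier K s \<ge> 1/4" if "cmod s < 1/K"
  proof -
    have "cmod s \<le> 1/4" using that K15(2) by simp
    moreover have "1/2 \<le> C" using C(4) that K0 by (simp add: field_simps)
    moreover have "20/K - 5/K \<le> 1/4" using K15 by (simp add: diff_divide_distrib[symmetric])
    ultimately show ?thesis using A20 unfolding barrier_def tau by simp
  qed
  show "barrier K s \<ge> - (15/K)" 
  proof -
    have "15/K = 20/K - 5/K" by (simp add: field_simps)
    then have "- (15/K) \<le> Re (barrier_tau K s)" "- (15/K) \<le> 0" unfolding tau using A20 C K15 K0 by simp_all
    then show ?thesis unfolding barrier_def by simp
  qed
  show "\<bar>barrier K s\<bar> \<le> 2" 
  proof -
    have "\<bar>Re (barrier_tau K s)\<bar> \<le> 2" unfolding tau using A20 C K15 by linarith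
    then show ?thesis unfolding barrier_def by (auto simp: min_def abs_le_iff)
  qed
qed

lemma continuous_on_barrier:
  assumes K: "K > 60"
  shows "continuous_on {s. Re s \<ge> 0} (barrier K)"
proof -
  have nz: "1 + of_real c * s \<noteq> 0" if "Re s \<ge> 0" "c \<ge> 0" for c s
    using cmod_one_plus_ge(1)[of "of_real c * s"] that by auto
  have tc: "continuous_on {s. Re s \<ge> 0} (barrier_tau K)"
    unfolding barrier_tau_def using nz[of _ 4] nz[of _ K] K by (intro continuous_intros) auto
  show ?thesis
    unfolding barrier_def
  proof (rule continuous_on_cases_le)
    show "Re (barrier_tau K s) = min 0 (Re (barrier_tau K s))" if "s \<in> {s. Re s \<ge> 0}" "cmod s = 1/4" for s
      using barrier_bounds(1)[of s K] that K by simp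
    show "continuous_on {t \<in> {s. 0 \<le> Re s}. cmod t \<le> 1/4} (\<lambda>s. Re (barrier_tau K s))"
      by (intro continuous_on_Re continuous_on_subset[OF tc]) auto
    show "continuous_on {t \<in> {s. 0 \<le> Re s}. 1/4 \<le> cmod t} (\<lambda>s. min 0 (Re (barrier_tau K s)))"
      by (intro continuous_on_min continuous_on_const continuous_on_Re continuous_on_subset[OF tc]) auto
    show "continuous_on {s. 0 \<le> Re s} cmod"
      by (intro continuous_on_norm_id)
  qed
qed

text \<open>The mean is bounded by the value at the centre, and |s 0| >= 1 places the centre where
  the barrier vanishes.\<close>

lemma barrier_circle_integral_le:
  assumes s: "s holomorphic_on ball 0 1" and pos: "\<And>z. z \<in> ball 0 1 \<Longrightarrow> Re (s z) \<ge> 0"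
    and K: "K > 60" and r: "0 < r" "r < 1" and s0: "cmod (s 0) \<ge> 1"
  shows "integral {0..2*pi} (\<lambda>t. barrier K (s (of_real r * cis t))) \<le> 0"
proof -
  have nz: "1 + of_real c * s z \<noteq> 0" if "z \<in> ball 0 1" "c \<ge> 0" for c z
    using cmod_one_plus_ge(1)[of "of_real c * s z"] pos[OF that(1)] that by auto
  have G: "(\<lambda>z. barrier_tau K (s z)) holomorphic_on ball 0 1"
    unfolding barrier_tau_def using nz[of _ 4] nz[of _ K] K by (intro holomorphic_intros s) auto
  have sub: "cball (0::complex) r \<subseteq> ball 0 1" "ball (0::complex) r \<subseteq> ball 0 1" using r by auto
  have "integral {0..2*pi} (\<lambda>t. barrier K (s (of_real r * cis t))) \<le> 2 * pi * barrier K (s 0)"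
    unfolding barrier_def
  proof (rule glued_min_super_mean(2)[of r s _ "1/5"])
    show "continuous_on (cball 0 r) s" "continuous_on (cball 0 r) (\<lambda>z. barrier_tau K (s z))"
      using sub(1) s G by (auto intro: holomorphic_on_imp_continuous_on holomorphic_on_subset)
    show "(\<lambda>z. barrier_tau K (s z)) holomorphic_on ball 0 r"
      using G sub(2) by (rule holomorphic_on_subset)
    show "Re (barrier_tau K (s z)) \<le> 0" if "z \<in> cball 0 r" "1/5 \<le> cmod (s z)" "cmod (s z) \<le> 1/4" for z
      using barrier_bounds(1)[of "s z" K] that pos[of z] sub(1) K by auto
  qed (use r in auto)
  also have "barrier K (s 0) = 0" using barrier_bounds(2)[of "s 0" K] s0 K pos[of 0] by simp
  finally show ?thesis by simp
qed

section \<open>Comparing Carleson boxes\<close>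

lemma radial_limit_unique:
  assumes "radial_limit \<phi> \<zeta> w" "radial_limit \<phi> \<zeta> w'"
  shows "w = w'"
  using assms unfolding radial_limit_def by (rule tendsto_unique[OF trivial_limit_at_left_real])

lemma radial_limit_cmod_le:
  assumes "\<phi> ` ball 0 1 \<subseteq> ball 0 1" "cmod \<zeta> = 1" "radial_limit \<phi> \<zeta> w"
  shows "cmod w \<le> 1"
proof (rule tendsto_upperbound)
  show "((\<lambda>r::real. cmod (\<phi> (of_real r * \<zeta>))) \<longlongrightarrow> cmod w) (at_left 1)"
    using assms(3) unfolding radial_limit_def by (rule tendsto_norm)
  have "\<forall>\<^sub>F r in at_left (1::real). r \<in> {0<..<1}"
    by (rule eventually_at_leftI[of 0]) auto
  then show "\<forall>\<^sub>F r in at_left (1::real). cmod (\<phi> (of_real r * \<zeta>)) \<le> 1"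
  proof eventually_elim
    case (elim r)
    then have "of_real r * \<zeta> \<in> ball 0 1" using assms(2) by (simp add: norm_mult)
    then have "\<phi> (of_real r * \<zeta>) \<in> ball 0 1" using assms(1) by blast
    then show ?case by simp
  qed
qed simp

text \<open>The preimage under the boundary function, moved to the angle variable so that all
  measure theory takes place on the line.\<close>

definition limit_angles :: "(complex \<Rightarrow> complex) \<Rightarrow> complex set \<Rightarrow> real set" where
  "limit_angles \<phi> E = {t \<in> {0..<2*pi}. \<exists>w\<in>E. radial_limit \<phi> (cis t) w}"

lemma pullback_measure_eq:
  "pullback_measure \<phi> E = measure lebesgue (limit_angles \<phi> E) / (2*pi)"
  by (simp add: pullback_measure_def circle_measure_def limit_angles_def)

text \<open>One sequence of radii for all functions and directions: measurability of limits and
  dominated convergence are statements about sequences.\<close>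

lemma radial_approach:
  obtains r :: "nat \<Rightarrow> real" where "\<And>n. 0 < r n" "\<And>n. r n < 1"
    "\<And>\<phi> \<zeta> w. radial_limit \<phi> \<zeta> w \<Longrightarrow> (\<lambda>n. \<phi> (of_real (r n) * \<zeta>)) \<longlonglongrightarrow> w"
proof
  \<comment> \<open>The double successor makes the first radius 1/2 instead of 0.\<close>
  let ?r = "\<lambda>n::nat. 1 - inverse (real (Suc (Suc n)))"
  show r: "0 < ?r n" "?r n < 1" for n by (simp_all add: field_simps)
  have "?r \<longlonglongrightarrow> 1 - 0"
    using LIMSEQ_Suc[OF LIMSEQ_inverse_real_of_nat] by (intro tendsto_diff tendsto_const)
  then have "filterlim ?r (at_left 1) sequentially"
    unfolding filterlim_at using r by (auto simp: less_imp_neq)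
  then show "(\<lambda>n. \<phi> (of_real (?r n) * \<zeta>)) \<longlonglongrightarrow> w" if "radial_limit \<phi> \<zeta> w" for \<phi> \<zeta> w
    using that unfolding radial_limit_def by (rule filterlim_compose[rotated])
qed

text \<open>Off the null set of Fatou's theorem this is the preimage of \<open>E\<close> under a
  pointwise limit of continuous functions; completeness of Lebesgue measure takes care of the
  rest.\<close>

lemma limit_angles_lmeasurable:
  assumes "\<phi> holomorphic_on ball 0 1" "\<phi> ` ball 0 1 \<subseteq> ball 0 1" "E \<in> sets borel"
  shows "limit_angles \<phi> E \<in> lmeasurable"
proof -
  obtain N where N: "negligible N" "\<And>t. t \<notin> N \<Longrightarrow> \<exists>w. radial_limit \<phi> (cis t) w"
    using Fatou_radial_limits[OF assms(1), of 1] assms(2) by (auto simp: image_subset_iff less_imp_le)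
  obtain r :: "nat \<Rightarrow> real" where r: "\<And>n. 0 < r n" "\<And>n. r n < 1"
    "\<And>\<phi> \<zeta> w. radial_limit \<phi> \<zeta> w \<Longrightarrow> (\<lambda>n. \<phi> (of_real (r n) * \<zeta>)) \<longlonglongrightarrow> w"
    using radial_approach by blast
  define L where "L t = lim (\<lambda>n. \<phi> (of_real (r n) * cis t))" for t
  have "(\<lambda>t. \<phi> (of_real (r n) * cis t)) \<in> borel_measurable lebesgue" for n
  proof -
    have "continuous_on UNIV (\<lambda>t. \<phi> (of_real (r n) * cis t))"
      by (rule continuous_on_compose2[OF holomorphic_on_imp_continuous_on[OF assms(1)]])
         (use r(1,2)[of n] in \<open>auto intro!: continuous_intros simp: norm_mult\<close>)
    then have "(\<lambda>t. \<phi> (of_real (r n) * cis t)) \<in> borel_measurable borel"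
      by (rule borel_measurable_continuous_onI)
    then show ?thesis using measurable_completion[of _ lborel borel] by simp
  qed
  then have Lm: "L \<in> borel_measurable lebesgue"
    unfolding L_def by (rule borel_measurable_lim_metric)
  have Leq: "L t = w" if "radial_limit \<phi> (cis t) w" for t w
    unfolding L_def using r(3)[OF that] by (rule limI)
  \<comment> \<open>On \<open>N\<close> the sequence may converge, or \<open>lim\<close> may be a
    default value, without a radial limit existing; so \<open>N\<close> is cut out and its part
    restored separately.\<close>
  have "limit_angles \<phi> E = (({0..<2*pi} \<inter> (L -` E \<inter> space lebesgue)) - N) \<union> (limit_angles \<phi> E \<inter> N)"
    unfolding limit_angles_def using N(2) Leq by fastforce
  moreover have "L -` E \<inter> space lebesgue \<in> sets lebesgue"
    using Lm assms(3) by (rule measurable_sets)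
  moreover have "N \<in> sets lebesgue" "limit_angles \<phi> E \<inter> N \<in> sets lebesgue"
    using N(1) negligible_subset[OF N(1), of "limit_angles \<phi> E \<inter> N"] by (auto intro: negligible_imp_sets)
  moreover have "{0..<2*pi} \<in> sets lebesgue" by simp
  ultimately have "limit_angles \<phi> E \<in> sets lebesgue"
    by (metis sets.Diff sets.Int sets.Un)
  then show ?thesis
    by (rule bounded_set_imp_lmeasurable[rotated])
       (rule bounded_subset[of "{0..2*pi}"], auto simp: limit_angles_def)
qed

lemma carleson_box_borel: "carleson_box \<xi> h \<in> sets borel"
proof -
  have "carleson_box \<xi> h = cball 0 1 \<inter> ball \<xi> h"
    by (auto simp: carleson_box_def dist_norm norm_minus_commute)
  then show ?thesis by simp
qed

lemma limit_angles_carleson_box_le: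
  assumes hol: "\<phi> holomorphic_on ball 0 1" and self: "\<phi> ` ball 0 1 \<subseteq> ball 0 1"
    and \<xi>: "cmod \<xi> = 1" and h: "0 < h" "h < 1 - cmod (\<phi> 0)" and \<epsilon>: "0 < \<epsilon>" "\<epsilon> < 1/60"
  shows "measure lebesgue (limit_angles \<phi> (carleson_box \<xi> (\<epsilon> * h)))
          \<le> 60 * \<epsilon> * measure lebesgue (limit_angles \<phi> (carleson_box \<xi> h))"
proof -
  let ?A = "limit_angles \<phi> (carleson_box \<xi> (\<epsilon> * h))"
  let ?B = "limit_angles \<phi> (carleson_box \<xi> h)"
  define K where "K = 1 / \<epsilon>"
  have K: "K > 60" using \<epsilon> by (simp add: K_def field_simps)
  define \<sigma> where "\<sigma> w = (1 - cnj \<xi> * w) / of_real h" for w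
  have \<sigma>_cmod: "cmod (\<sigma> w) = cmod (w - \<xi>) / h" for w
  proof -
    have "1 - cnj \<xi> * w = cnj \<xi> * (\<xi> - w)"
      using complex_norm_square[of \<xi>] \<xi> by (simp add: algebra_simps)
    then show ?thesis using \<xi> h(1) by (simp add: \<sigma>_def norm_divide norm_mult norm_minus_commute)
  qed
  have \<sigma>_Re: "Re (\<sigma> w) \<ge> 0" if "cmod w \<le> 1" for w
  proof -
    have "Re (cnj \<xi> * w) \<le> cmod (cnj \<xi> * w)" by (rule complex_Re_le_cmod)
    also have "\<dots> \<le> 1" using \<xi> that by (simp add: norm_mult)
    finally have "Re (1 - cnj \<xi> * w) \<ge> 0" by simp
    then show ?thesis using h(1) by (simp add: \<sigma>_def)
  qed
  obtain N where N: "negligible N" "\<And>t. t \<notin> N \<Longrightarrow> \<exists>w. radial_limit \<phi> (cis t) w"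
    using Fatou_radial_limits[OF hol, of 1] self by (auto simp: image_subset_iff less_imp_le)
  obtain r :: "nat \<Rightarrow> real" where r: "\<And>n. 0 < r n" "\<And>n. r n < 1"
    "\<And>\<phi> \<zeta> w. radial_limit \<phi> \<zeta> w \<Longrightarrow> (\<lambda>n. \<phi> (of_real (r n) * \<zeta>)) \<longlonglongrightarrow> w"
    using radial_approach by blast
  define L where "L t = (SOME w. radial_limit \<phi> (cis t) w)" for t
  have L: "radial_limit \<phi> (cis t) (L t)" if "t \<notin> N" for t
    unfolding L_def using N(2)[OF that] by (rule someI_ex)
  have L1: "cmod (L t) \<le> 1" if "t \<notin> N" for t
    using radial_limit_cmod_le[OF self _ L[OF that]] by simp
  have Am: "?A \<in> lmeasurable" and Bm: "?B \<in> lmeasurable"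
    by (intro limit_angles_lmeasurable hol self carleson_box_borel)+
  \<comment> \<open>On \<open>S\<close> the integrands converge at every point; it differs from the
    closed interval by a null set, so no integral changes.\<close>
  define S where "S = {0..<2*pi} - N"
  define f where "f n t = barrier K (\<sigma> (\<phi> (of_real (r n) * cis t)))" for n t
  define g where "g t = barrier K (\<sigma> (L t))" for t
  have in_ball: "of_real (r n) * cis t \<in> ball 0 1" for n t using r(1,2)[of n] by (simp add: norm_mult)
  have \<phi>1: "cmod (\<phi> (of_real (r n) * cis t)) \<le> 1" for n t
    using self in_ball[of n t] by (auto simp: image_subset_iff less_imp_le)
  have f_cont: "continuous_on {0..2*pi} (f n)" for n
  proof -
    have "continuous_on {0..2*pi} (\<lambda>t. \<phi> (of_real (r n) * cis t))"
      by (rule continuous_on_compose2[OF holomorphic_on_imp_continuous_on[OF hol]])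
         (use in_ball in \<open>auto intro!: continuous_intros\<close>)
    then have "continuous_on {0..2*pi} (\<lambda>t. \<sigma> (\<phi> (of_real (r n) * cis t)))"
      unfolding \<sigma>_def using h(1) by (intro continuous_intros) auto
    then show ?thesis unfolding f_def
      by (rule continuous_on_compose2[OF continuous_on_barrier[OF K]]) (use \<sigma>_Re \<phi>1 in auto)
  qed
  have neg1: "negligible {x \<in> {0..2*pi} - S. u x \<noteq> 0}" for u :: "real \<Rightarrow> real"
    by (rule negligible_subset[of "insert (2*pi) N"]) (use N(1) in \<open>auto simp: S_def\<close>)
  have neg2: "negligible {x \<in> S - {0..2*pi}. u x \<noteq> 0}" for u :: "real \<Rightarrow> real"
    by (rule negligible_subset[of "{}"]) (auto simp: S_def)
  have f_int: "f n integrable_on S" for n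
    using integrable_spike_set[OF integrable_continuous_real[OF f_cont] neg1 neg2] .
  have f_le: "integral S (f n) \<le> 0" for n
  proof -
    have "integral {0..2*pi} (f n) \<le> 0"
      unfolding f_def
    proof (rule barrier_circle_integral_le[where s = "\<lambda>z. \<sigma> (\<phi> z)"])
      show "(\<lambda>z. \<sigma> (\<phi> z)) holomorphic_on ball 0 1"
        unfolding \<sigma>_def using h(1) by (intro holomorphic_intros hol) auto
      show "Re (\<sigma> (\<phi> z)) \<ge> 0" if "z \<in> ball 0 1" for z
        using self that by (intro \<sigma>_Re) (auto simp: image_subset_iff less_imp_le)
      \<comment> \<open>Here the upper bound on \<open>h\<close> enters: \<phi> 0 lies outside the
        larger box, so the barrier vanishes at the starting point.\<close>
      have "1 - cmod (\<phi> 0) \<le> cmod (\<phi> 0 - \<xi>)"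
        using norm_triangle_ineq2[of \<xi> "\<phi> 0"] \<xi> by (simp add: norm_minus_commute)
      then show "cmod (\<sigma> (\<phi> 0)) \<ge> 1" unfolding \<sigma>_cmod using h by simp
    qed (use K r in auto)
    moreover have "integral {0..2*pi} (f n) = integral S (f n)"
      by (rule integral_spike_set[OF neg1 neg2])
    ultimately show ?thesis by simp
  qed
  have lim: "(\<lambda>n. f n t) \<longlonglongrightarrow> g t" if "t \<in> S" for t
  proof -
    have t: "t \<notin> N" using that by (simp add: S_def)
    have "(\<lambda>n. \<sigma> (\<phi> (of_real (r n) * cis t))) \<longlonglongrightarrow> \<sigma> (L t)"
      unfolding \<sigma>_def using h(1) by (intro tendsto_intros r(3) L t) auto
    then show ?thesis
      unfolding f_def g_def
      by (rule continuous_on_tendsto_compose[OF continuous_on_barrier[OF K]])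
         (use \<sigma>_Re \<phi>1 L1[OF t] in auto)
  qed
  have S_m: "S \<in> lmeasurable"
  proof (rule bounded_set_imp_lmeasurable)
    show "bounded S" by (rule bounded_subset[of "{0..2*pi}"]) (auto simp: S_def)
    show "S \<in> sets lebesgue" unfolding S_def
      using negligible_imp_sets[OF N(1)] by (intro sets.Diff) simp_all
  qed
  have bound: "norm (f n t) \<le> 2" for n t
    using barrier_bounds(5)[OF \<sigma>_Re[OF \<phi>1] K] by (simp add: f_def)
  have two: "(\<lambda>_. 2::real) integrable_on S"
    using integrable_on_cmult_left[OF lmeasurable_iff_integrable_on[THEN iffD1, OF S_m], of 2] by simp
  have g: "g integrable_on S" "(\<lambda>n. integral S (f n)) \<longlonglongrightarrow> integral S g"
    using dominated_convergence[OF f_int two bound lim] by auto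
  have g0: "integral S g \<le> 0"
    using g(2) f_le by (intro LIMSEQ_le_const2) auto
  have ind: "(indicator E :: real \<Rightarrow> real) integrable_on S" "integral S (indicator E) = measure lebesgue E"
    if "E \<in> lmeasurable" "E \<subseteq> {0..<2*pi}" for E
  proof -
    have ES: "E \<inter> S = E - N" using that(2) by (auto simp: S_def)
    have m: "E \<inter> S \<in> lmeasurable" using that S_m by auto
    then show "(indicator E :: real \<Rightarrow> real) integrable_on S" by (simp add: integrable_on_indicator)
    have "integral S (indicator E) = measure lebesgue (E \<inter> S)" using m by (rule integral_indicator)
    also have "\<dots> = measure lebesgue E"
      unfolding ES using that N(1) by (intro measure_Diff_null_set) (auto simp: negligible_iff_null_sets)
    finally show "integral S (indicator E) = measure lebesgue E" .
  qed
  have sub: "?A \<subseteq> {0..<2*pi}" "?B \<subseteq> {0..<2*pi}" by (auto simp: limit_angles_def)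
  have iA: "(\<lambda>t. 1/4 * indicator ?A t :: real) integrable_on S"
    and iB: "(\<lambda>t. 15/K * indicator ?B t :: real) integrable_on S"
    by (intro integrable_on_mult_right ind(1) Am Bm sub)+
  have "integral S (\<lambda>t. 1/4 * indicator ?A t - 15/K * indicator ?B t) \<le> integral S g"
  \<comment> \<open>Three regions: on \<open>?A\<close> the barrier is at least 1/4, on the rest of
    \<open>?B\<close> at least -15/K, and off \<open>?B\<close> it is 0.\<close>
  proof (rule integral_le[OF integrable_diff[OF iA iB] g(1)])
    fix t assume t: "t \<in> S"
    then have tN: "t \<notin> N" and t2: "t \<in> {0..<2*pi}" by (auto simp: S_def)
    have mem: "t \<in> limit_angles \<phi> (carleson_box \<xi> d) \<longleftrightarrow> cmod (L t - \<xi>) < d" for d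
    proof -
      have "(\<exists>w\<in>E. radial_limit \<phi> (cis t) w) \<longleftrightarrow> L t \<in> E" for E
        using radial_limit_unique[OF L[OF tN]] L[OF tN] by blast
      then have "t \<in> limit_angles \<phi> (carleson_box \<xi> d) \<longleftrightarrow> L t \<in> carleson_box \<xi> d"
        using t2 by (simp add: limit_angles_def)
      then show ?thesis using L1[OF tN] by (simp add: carleson_box_def)
    qed
    note b = barrier_bounds[OF \<sigma>_Re[OF L1[OF tN]] K, folded g_def]
    have K0: "15/K \<ge> 0" using K by simp
    show "1/4 * indicator ?A t - 15/K * indicator ?B t \<le> g t"
    proof (cases "t \<in> ?A")
      case True
      then have "cmod (\<sigma> (L t)) < 1/K"
        using mem h(1) \<epsilon> unfolding \<sigma>_cmod K_def by (simp add: field_simps)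
      then have "1/4 \<le> g t" by (rule b(3))
      moreover have "15/K * indicator ?B t \<ge> 0" using K0 by (intro mult_nonneg_nonneg) auto
      ultimately show ?thesis using True by simp
    next
      case False
      show ?thesis
      proof (cases "t \<in> ?B")
        case True
        then show ?thesis using False b(4) by simp
      next
        case nB: False
        then have "1 \<le> cmod (\<sigma> (L t))" using mem h(1) unfolding \<sigma>_cmod by simp
        then show ?thesis using False nB b(2) by simp
      qed
    qed
  qed
  moreover have "integral S (\<lambda>t. 1/4 * indicator ?A t - 15/K * indicator ?B t)
      = 1/4 * measure lebesgue ?A - 15/K * measure lebesgue ?B"
    using integral_diff[OF iA iB] ind(2)[OF Am sub(1)] ind(2)[OF Bm sub(2)] by simp
  ultimately have "1/4 * measure lebesgue ?A - 15/K * measure lebesgue ?B \<le> 0" using g0 by linarith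
  then show ?thesis by (simp add: K_def)
qed

theorem mainTheorem14:
  shows "\<exists>k1::real. k1 > 0 \<and>
    (\<forall>(\<phi>::complex \<Rightarrow> complex) (\<xi>::complex) (h::real) (\<epsilon>::real).
      \<phi> holomorphic_on ball 0 1 \<and> \<phi> ` ball 0 1 \<subseteq> ball 0 1 \<and>
      cmod \<xi> = 1 \<and> 0 < h \<and> h < 1 - cmod (\<phi> 0) \<and> 0 < \<epsilon> \<and> \<epsilon> < 1 \<longrightarrow>
      pullback_measure \<phi> (carleson_box \<xi> (\<epsilon> * h))
        \<le> k1 * \<epsilon> * pullback_measure \<phi> (carleson_box \<xi> h))"
proof (intro exI[of _ 60] conjI allI impI)
  fix \<phi> :: "complex \<Rightarrow> complex" and \<xi> :: complex and h \<epsilon> :: real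
  assume H: "\<phi> holomorphic_on ball 0 1 \<and> \<phi> ` ball 0 1 \<subseteq> ball 0 1 \<and>
      cmod \<xi> = 1 \<and> 0 < h \<and> h < 1 - cmod (\<phi> 0) \<and> 0 < \<epsilon> \<and> \<epsilon> < 1"
  let ?A = "limit_angles \<phi> (carleson_box \<xi> (\<epsilon> * h))"
  let ?B = "limit_angles \<phi> (carleson_box \<xi> h)"
  have "measure lebesgue ?A \<le> 60 * \<epsilon> * measure lebesgue ?B"
  proof (cases "\<epsilon> < 1/60")
    case True
    then show ?thesis using H by (intro limit_angles_carleson_box_le) auto
  next
    case False
    \<comment> \<open>Now 60 * \<epsilon> >= 1, so inclusion of the boxes suffices.\<close>
    have "\<epsilon> * h \<le> h" using H by (simp add: mult_le_cancel_right1)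
    then have "?A \<subseteq> ?B" by (auto simp: limit_angles_def carleson_box_def)
    moreover have "?A \<in> lmeasurable" "?B \<in> lmeasurable"
      using H by (auto intro!: limit_angles_lmeasurable carleson_box_borel)
    ultimately have "measure lebesgue ?A \<le> 1 * measure lebesgue ?B"
      by (simp add: measure_mono_fmeasurable fmeasurableD)
    also have "\<dots> \<le> 60 * \<epsilon> * measure lebesgue ?B"
      using False by (intro mult_right_mono) auto
    finally show ?thesis .
  qed
  then show "pullback_measure \<phi> (carleson_box \<xi> (\<epsilon> * h)) \<le> 60 * \<epsilon> * pullback_measure \<phi> (carleson_box \<xi> h)"
    unfolding pullback_measure_eq times_divide_eq_right by (rule divide_right_mono) simp
qed simp

end
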